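(* Let $\alpha,\beta>0$ and let $$\Omega:=\{z\in\mathbb{C}:\ \operatorname{Re} z>-c_1(1+|\operatorname{Im} z|)^{-\alpha}\},$$ where $c_1>0$ is fixed. Let $(T(t))_{t\ge0}$ be a $C_0$-semigroup on a Banach space $X$ with generator $A$, such that $\sup_{t\ge0}\|T(t)\|:=M<\infty$, and let $T_1$ and $T_2$ be bounded operators on $X$. Suppose that $F(z)=T_1R(z,A)T_2$ admits a holomorphic extension to the domain $\Omega$, and suppose that $$\|F(z)\|\le M_1(1+|\operatorname{Im} z|)^{\beta},\qquad z\in\Omega.$$ Then there exists $c=c(M,M_1,\alpha,\beta)>0$ such that $$\|T_1T(t)(I-A)^{-1}T_2\|\le c\Bigl(\frac{\log t}{t}\Bigr)^{1/\alpha},\qquad t\ge2.$$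
   Context: $R(z,A)=(z-A)^{-1}$ denotes the resolvent of $A$. Since the semigroup is bounded, $F$ is initially defined and holomorphic in the half-plane $\{\operatorname{Re} z>0\}$; its extension to $\Omega$ is still denoted by $F$. $M_1$ is a constant.
   Formalization: The constant c may depend also on c_1 and on the norms of T_1 and T_2 (a c independent of these norms does not exist in general), and c is obtained for each Banach space X separately; uniformity in X follows by passing to direct sums. *)

theory Defs
  imports "HOL-Analysis.Analysis"
begin

class scaleC =
  fixes scaleC :: "complex \<Rightarrow> 'a \<Rightarrow> 'a"  (infixr "*\<^sub>C" 75)

class complex_normed_vector = real_normed_vector + scaleC +
  assumes scaleC_add_right: "a *\<^sub>C (x + y) = a *\<^sub>C x + a *\<^sub>C y"
    and scaleC_add_left: "(a + b) *\<^sub>C x = a *\<^sub>C x + b *\<^sub>C x"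
    and scaleC_scaleC: "a *\<^sub>C b *\<^sub>C x = (a * b) *\<^sub>C x"
    and scaleC_of_real: "complex_of_real r *\<^sub>C x = r *\<^sub>R x"
    and norm_scaleC: "norm (a *\<^sub>C x) = cmod a * norm x"

class complex_banach = complex_normed_vector + banach

instantiation complex :: complex_banach
begin

definition scaleC_complex :: "complex \<Rightarrow> complex \<Rightarrow> complex"
  where "scaleC_complex a x = a * x"

instance
  by standard (auto simp: scaleC_complex_def algebra_simps norm_mult scaleR_conv_of_real)

end

lemma bounded_linear_scaleC:
  "bounded_linear (\<lambda>x :: 'a :: complex_normed_vector. a *\<^sub>C x)"
proof (rule bounded_linear_intro[where K = "cmod a"])
  fix r :: real and x y :: 'a
  show "a *\<^sub>C (x + y) = a *\<^sub>C x + a *\<^sub>C y"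
    by (rule scaleC_add_right)
  show "a *\<^sub>C (r *\<^sub>R x) = r *\<^sub>R (a *\<^sub>C x)"
    by (simp add: scaleC_of_real[symmetric] scaleC_scaleC mult.commute)
  show "norm (a *\<^sub>C x) \<le> norm x * cmod a"
    by (simp add: norm_scaleC mult.commute)
qed

text \<open>
  The type of bounded operators consists of the \<^emph>\<open>real\<close>-linear ones; complex scalars act on it
  through the codomain.
\<close>

instantiation blinfun :: (real_normed_vector, complex_normed_vector) complex_normed_vector
begin

definition scaleC_blinfun :: "complex \<Rightarrow> ('a \<Rightarrow>\<^sub>L 'b) \<Rightarrow> 'a \<Rightarrow>\<^sub>L 'b"
  where "scaleC_blinfun a f = Blinfun (\<lambda>x. a *\<^sub>C blinfun_apply f x)"

lemma blinfun_apply_scaleC [simp]: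
  "blinfun_apply (a *\<^sub>C f) x = a *\<^sub>C blinfun_apply (f :: 'a \<Rightarrow>\<^sub>L 'b) x"
proof -
  have "bounded_linear (\<lambda>x. a *\<^sub>C blinfun_apply f x)"
    using bounded_linear_compose[OF bounded_linear_scaleC blinfun.bounded_linear_right] .
  then show ?thesis
    by (simp add: scaleC_blinfun_def bounded_linear_Blinfun_apply)
qed

instance
proof
  fix a b :: complex and r :: real and f g :: "'a \<Rightarrow>\<^sub>L 'b"
  show "a *\<^sub>C (f + g) = a *\<^sub>C f + a *\<^sub>C g"
    by (rule blinfun_eqI) (simp add: blinfun.add_left scaleC_add_right)
  show "(a + b) *\<^sub>C f = a *\<^sub>C f + b *\<^sub>C f"
    by (rule blinfun_eqI) (simp add: blinfun.add_left scaleC_add_left)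
  show "a *\<^sub>C b *\<^sub>C f = (a * b) *\<^sub>C f"
    by (rule blinfun_eqI) (simp add: scaleC_scaleC)
  show "complex_of_real r *\<^sub>C f = r *\<^sub>R f"
    by (rule blinfun_eqI) (simp add: blinfun.scaleR_left scaleC_of_real)
  show "norm (a *\<^sub>C f) = cmod a * norm f"
  proof -
    have le: "norm (a *\<^sub>C f) \<le> cmod a * norm f" for a and f :: "'a \<Rightarrow>\<^sub>L 'b"
      by (rule norm_blinfun_bound)
        (auto simp: norm_scaleC mult.assoc intro: mult_left_mono norm_blinfun)
    show ?thesis
    proof (cases "a = 0")
      case True
      then show ?thesis using le[of 0 f] by simp
    next
      case False
      have "inverse a *\<^sub>C a *\<^sub>C f = f"
        using False
        by (intro blinfun_eqI) (simp add: scaleC_scaleC scaleC_of_real[of 1, simplified])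
      then have "norm f \<le> inverse (cmod a) * norm (a *\<^sub>C f)"
        using le[of "inverse a" "a *\<^sub>C f"] by (simp add: norm_inverse)
      then have "cmod a * norm f \<le> norm (a *\<^sub>C f)"
        using False by (simp add: field_simps)
      then show ?thesis using le[of a f] by simp
    qed
  qed
qed

end

instance blinfun :: (real_normed_vector, complex_banach) complex_banach ..

text \<open>
  The space of bounded complex-linear operators.  The real operator norm of its elements
  coincides with their usual operator norm.
\<close>

definition complex_blinfuns :: "('a :: complex_normed_vector \<Rightarrow>\<^sub>L 'b :: complex_normed_vector) set"
  where "complex_blinfuns = {f. \<forall>a x. blinfun_apply f (a *\<^sub>C x) = a *\<^sub>C blinfun_apply f x}"

text \<open>Holomorphy of a vector-valued function, in the norm topology.\<close>

definition vector_holomorphic_on ::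
    "(complex \<Rightarrow> 'a :: complex_normed_vector) \<Rightarrow> complex set \<Rightarrow> bool"
    (infixl "vector'_holomorphic'_on" 50)
  where "f vector_holomorphic_on S \<longleftrightarrow>
    (\<forall>z\<in>S. \<exists>d. ((\<lambda>w. inverse (w - z) *\<^sub>C (f w - f z)) \<longlongrightarrow> d) (at z within S))"

text \<open>Only the values at nonnegative times matter.\<close>

definition C0_semigroup :: "(real \<Rightarrow> 'a :: complex_normed_vector \<Rightarrow>\<^sub>L 'a) \<Rightarrow> bool"
  where "C0_semigroup T \<longleftrightarrow>
    (\<forall>t\<ge>0. T t \<in> complex_blinfuns) \<and>
    T 0 = id_blinfun \<and>
    (\<forall>s\<ge>0. \<forall>t\<ge>0. T (s + t) = T s o\<^sub>L T t) \<and>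
    (\<forall>x. ((\<lambda>t. blinfun_apply (T t) x) \<longlongrightarrow> x) (at_right 0))"

text \<open>Unbounded operators are represented by their graphs.\<close>

definition generator ::
    "(real \<Rightarrow> 'a :: complex_normed_vector \<Rightarrow>\<^sub>L 'a) \<Rightarrow> ('a \<times> 'a) set"
  where "generator T =
    {(x, y). ((\<lambda>h. (blinfun_apply (T h) x - x) /\<^sub>R h) \<longlongrightarrow> y) (at_right 0)}"

text \<open>
  \<open>resolvent z A\<close> is the everywhere defined bounded inverse of \<open>z - A\<close>: its graph is the converse
  of the graph of \<open>z - A\<close>.  It is unspecified if there is no such inverse.
\<close>

definition resolvent ::
    "complex \<Rightarrow> ('a :: complex_normed_vector \<times> 'a) set \<Rightarrow> 'a \<Rightarrow>\<^sub>L 'a"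
  where "resolvent z A =
    (THE R. {(y, x). x = blinfun_apply R y} = {(z *\<^sub>C x - w, x) | x w. (x, w) \<in> A})"

definition Omega :: "real \<Rightarrow> real \<Rightarrow> complex set"
  where "Omega \<alpha> c1 = {z. Re z > - c1 * (1 + \<bar>Im z\<bar>) powr (- \<alpha>)}"

end

theory Submission
  imports Defs "HOL-Complex_Analysis.Cauchy_Integral_Formula"
begin

text \<open>
  For a bounded semigroup, the vector \<open>T(t) R(1,A) y\<close> is \<open>e\<^sup>t\<close> times the tail
  beyond time \<open>t\<close> of the Laplace integral of the orbit of \<open>y\<close> at the point 1.  Hence, for a bounded
  functional \<open>\<phi>\<close>, the number \<open>\<phi>(T\<^sub>1 T(t) R(1,A) T\<^sub>2 x)\<close> equals \<open>e\<^sup>t (f(1) - f\<^sub>t(1))\<close>, where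
  \<open>f(z) = \<phi>(F(z) x)\<close> is the Laplace transform of the bounded continuous function
  \<open>g(s) = \<phi>(T\<^sub>1 T(s) T\<^sub>2 x)\<close> and \<open>f\<^sub>t\<close> is the transform of \<open>g\<close> truncated at \<open>t\<close>.  A functional that is
  norming for the vector in question (\<open>exists_norming_functional\<close>, by Hahn--Banach) thus reduces the
  theorem to scalar functions, with constants that depend only on the region and on bounds
  for \<open>g\<close>, \<open>f\<close> and \<open>f - f\<^sub>t\<close>.

  The scalar estimate is Newman's contour method, with the pole at 1 instead of 0.  The functions
  \<open>f(z) e\<^bsup>tz\<^esup> (1 + z\<^sup>2/R\<^sup>2)\<^sup>k / (z - 1)\<close> and its analogue for \<open>f\<^sub>t\<close> are integrated over rectangles of height
  \<open>2 R\<close> (\<open>newman_estimate\<close>).  Away from the imaginary axis both \<open>e\<^bsup>tz\<^esup> (f - f\<^sub>t)\<close> on the right and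
  \<open>e\<^bsup>tz\<^esup> f\<^sub>t\<close> on the left are bounded by a constant over \<open>\<bar>Re z\<bar>\<close>.  One of the zeros of the kernel at \<open>\<plusminus>\<i>R\<close>
  makes up for this singularity, so these parts contribute \<open>O(1/R)\<close>.
  On the left, \<open>f\<close> is available only to the depth \<open>\<delta>\<close> of order \<open>R\<^bsup>-\<alpha>\<^esup>\<close>, where it is of order
  \<open>R\<^sup>\<beta>\<close>.  The high order \<open>k\<close> of the zeros of the kernel at \<open>\<plusminus>\<i>R\<close> and the factor \<open>e\<^bsup>-\<delta>t\<^esup>\<close> make this part
  \<open>O(1/R)\<close> too, provided that \<open>\<delta> t\<close> is at least a suitable multiple of \<open>ln R\<close>.  The largest such \<open>R\<close> is
  of order \<open>(t / ln t)\<^bsup>1/\<alpha>\<^esup>\<close> (\<open>balanced_scale\<close>), and \<open>1/R\<close> is the rate in the theorem.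
\<close>

section \<open>Resolvents of bounded semigroups\<close>

lemma scaleC_scaleR: "a *\<^sub>C r *\<^sub>R x = r *\<^sub>R a *\<^sub>C (x :: 'a :: complex_normed_vector)"
  by (simp add: scaleC_of_real[symmetric] scaleC_scaleC mult.commute)

lemma scaleC_one [simp]: "1 *\<^sub>C x = (x :: 'a :: complex_normed_vector)"
  using scaleC_of_real[of 1 x] by simp

lemma bounded_bilinear_scaleC:
  "bounded_bilinear (\<lambda>a (x :: 'a :: complex_normed_vector). a *\<^sub>C x)"
proof
  show "\<exists>K. \<forall>a (x :: 'a). norm (a *\<^sub>C x) \<le> norm a * norm x * K"
    by (intro exI[of _ 1]) (simp add: norm_scaleC)
  show "(r *\<^sub>R a) *\<^sub>C (x :: 'a) = r *\<^sub>R a *\<^sub>C x" for r a x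
    by (simp add: scaleR_conv_of_real scaleC_scaleC[symmetric] scaleC_of_real)
qed (simp_all add: scaleC_add_left scaleC_add_right scaleC_scaleR)

lemmas continuous_on_scaleC [continuous_intros] =
  bounded_bilinear.continuous_on[OF bounded_bilinear_scaleC]
lemmas tendsto_scaleC [tendsto_intros] =
  bounded_bilinear.tendsto[OF bounded_bilinear_scaleC]
lemmas has_vector_derivative_scaleC =
  bounded_bilinear.has_vector_derivative[OF bounded_bilinear_scaleC]

context
  fixes T :: "real \<Rightarrow> 'a :: complex_banach \<Rightarrow>\<^sub>L 'a"
begin

definition laplace_upto :: "complex \<Rightarrow> real \<Rightarrow> 'a \<Rightarrow> 'a"
  where "laplace_upto z t x = integral {0..t} (\<lambda>s. exp (- (of_real s * z)) *\<^sub>C T s x)"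

context
  fixes M :: real
  assumes T: "C0_semigroup T"
    and M: "\<And>t. 0 \<le> t \<Longrightarrow> norm (T t) \<le> M"
begin

lemma semigroup_0 [simp]: "blinfun_apply (T 0) x = x"
  using T by (simp add: C0_semigroup_def)

lemma semigroup_add: "0 \<le> s \<Longrightarrow> 0 \<le> t \<Longrightarrow> blinfun_apply (T (s + t)) x = T s (T t x)"
  using T by (simp add: C0_semigroup_def)

lemma semigroup_scaleC: "0 \<le> t \<Longrightarrow> blinfun_apply (T t) (c *\<^sub>C x) = c *\<^sub>C T t x"
  using T by (simp add: C0_semigroup_def complex_blinfuns_def)

lemma semigroup_bound_nonneg: "0 \<le> M"
  using M[of 0] norm_ge_zero[of "T 0"] by linarith

lemma semigroup_norm_le: "0 \<le> t \<Longrightarrow> norm (T t x) \<le> M * norm x"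
  using norm_blinfun[of "T t" x] M[of t] by (meson mult_right_mono norm_ge_zero order_trans)

text \<open>
  Two points of an orbit differ by \<open>T s\<close> applied to \<open>T h x - x\<close>, where \<open>s\<close> is the smaller time and \<open>h\<close>
  the difference.  Boundedness of the semigroup then turns right continuity at 0 into continuity.
\<close>

lemma semigroup_continuous_on: "continuous_on {0..} (\<lambda>t. T t x)"
proof -
  have lim: "((\<lambda>h. M * norm (T h x - x)) \<longlongrightarrow> 0) (at_right 0)"
  proof -
    have "((\<lambda>h. T h x) \<longlongrightarrow> x) (at_right 0)"
      using T by (simp add: C0_semigroup_def)
    then have "((\<lambda>h. M * norm (T h x - x)) \<longlongrightarrow> M * norm (x - x)) (at_right 0)"
      by (intro tendsto_intros)
    then show ?thesis by simp
  qed
  have diff: "dist (T s x) (T t x) \<le> M * norm (T \<bar>s - t\<bar> x - x)" if "0 \<le> s" "0 \<le> t" for s t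
    using that
  proof (induction s t rule: linorder_wlog)
    case (le s t)
    then have "T s x - T t x = - T s (T (t - s) x - x)"
      using semigroup_add[of s "t - s" x] by (simp add: blinfun.diff_right)
    then show ?case
      using le semigroup_norm_le[of s "T (t - s) x - x"] by (simp add: dist_norm abs_minus_commute)
  qed (simp add: dist_commute abs_minus_commute)
  show ?thesis
    unfolding continuous_on_iff
  proof (intro ballI allI impI)
    fix t e :: real
    assume t: "t \<in> {0..}" and e: "0 < e"
    obtain d where d: "0 < d" "\<And>h. 0 < h \<Longrightarrow> h < d \<Longrightarrow> M * norm (T h x - x) < e"
      using order_tendstoD(2)[OF lim e] unfolding eventually_at_right_field by auto
    have "dist (T s x) (T t x) < e" if "s \<in> {0..}" "dist s t < d" for s
      using diff[of s t] d(2)[of "\<bar>s - t\<bar>"] that t e by (cases "s = t") (auto simp: dist_real_def)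
    then show "\<exists>d>0. \<forall>s\<in>{0..}. dist s t < d \<longrightarrow> dist (T s x) (T t x) < e"
      using d(1) by blast
  qed
qed

lemma scaled_orbit_continuous_on:
  "continuous_on {0..} (\<lambda>s. exp (- (of_real s * z)) *\<^sub>C T s x)"
  by (intro continuous_intros semigroup_continuous_on)

lemma scaled_orbit_integrable:
  assumes "0 \<le> a"
  shows "(\<lambda>s. exp (- (of_real s * z)) *\<^sub>C T s x) integrable_on {a..b}"
  using assms by (intro integrable_continuous_real continuous_on_subset[OF scaled_orbit_continuous_on]) auto

lemma laplace_upto_linear:
  assumes "0 \<le> t"
  shows "laplace_upto z t (x + y) = laplace_upto z t x + laplace_upto z t y"
    and "laplace_upto z t (c *\<^sub>C x) = c *\<^sub>C laplace_upto z t x"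
proof -
  show "laplace_upto z t (x + y) = laplace_upto z t x + laplace_upto z t y"
    unfolding laplace_upto_def blinfun.add_right scaleC_add_right
    by (intro integral_add scaled_orbit_integrable) simp_all
  have "c *\<^sub>C laplace_upto z t x = integral {0..t} (\<lambda>s. c *\<^sub>C exp (- (of_real s * z)) *\<^sub>C T s x)"
    unfolding laplace_upto_def
    using integral_linear[OF scaled_orbit_integrable[OF order_refl] bounded_linear_scaleC]
    by (simp add: o_def)
  also have "\<dots> = laplace_upto z t (c *\<^sub>C x)"
    unfolding laplace_upto_def
    by (intro integral_cong) (auto simp: semigroup_scaleC scaleC_scaleC mult.commute)
  finally show "laplace_upto z t (c *\<^sub>C x) = c *\<^sub>C laplace_upto z t x" ..
qed

text \<open>
  With \<open>a = 0\<close> this bounds the resolvent, and with large \<open>a\<close> it shows that the truncated Laplace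
  transforms converge.
\<close>

lemma laplace_tail_bound:
  assumes z: "0 < Re z" and ab: "0 \<le> a" "a \<le> b"
  shows "norm (integral {a..b} (\<lambda>s. exp (- (of_real s * z)) *\<^sub>C T s x))
    \<le> exp (- (a * Re z)) * (M * norm x / Re z)"
proof -
  let ?C = "M * norm x"
  have "((\<lambda>s. exp (- (s * Re z)) * ?C) has_integral
      (- (exp (- (b * Re z)) * ?C / Re z) - (- (exp (- (a * Re z)) * ?C / Re z)))) {a..b}"
    using z ab
    by (intro fundamental_theorem_of_calculus)
      (auto intro!: derivative_eq_intros
        simp: has_real_derivative_iff_has_vector_derivative[symmetric] field_simps)
  note int = this
  have "norm (integral {a..b} (\<lambda>s. exp (- (of_real s * z)) *\<^sub>C T s x))
      \<le> integral {a..b} (\<lambda>s. exp (- (s * Re z)) * ?C)"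
  proof (rule integral_norm_bound_integral)
    show "(\<lambda>s. exp (- (s * Re z)) * ?C) integrable_on {a..b}"
      using int by blast
    fix s assume "s \<in> {a..b}"
    then show "norm (exp (- (of_real s * z)) *\<^sub>C T s x) \<le> exp (- (s * Re z)) * ?C"
      using ab semigroup_norm_le[of s x] by (auto simp: norm_scaleC intro!: mult_left_mono)
  qed (use ab in \<open>auto intro: scaled_orbit_integrable\<close>)
  also have "\<dots> = exp (- (a * Re z)) * ?C / Re z - exp (- (b * Re z)) * ?C / Re z"
    using integral_unique[OF int] by simp
  also have "\<dots> \<le> exp (- (a * Re z)) * (?C / Re z)"
    using z semigroup_bound_nonneg by simp
  finally show ?thesis .
qed

lemma laplace_upto_bound:
  assumes "0 < Re z" "0 \<le> t"
  shows "norm (laplace_upto z t x) \<le> M * norm x / Re z"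
  using laplace_tail_bound[OF assms(1) order_refl assms(2)] by (simp add: laplace_upto_def)

lemma laplace_upto_diff:
  assumes "0 \<le> s" "s \<le> t"
  shows "laplace_upto z t x - laplace_upto z s x
    = integral {s..t} (\<lambda>s. exp (- (of_real s * z)) *\<^sub>C T s x)"
  using Henstock_Kurzweil_Integration.integral_combine[OF assms scaled_orbit_integrable[of 0], of z x]
  by (simp add: laplace_upto_def algebra_simps)


lemma laplace_tail_tendsto_0:
  assumes z: "0 < Re z"
  shows "(\<lambda>n. exp (- (real n * Re z)) * (M * norm x / Re z)) \<longlonglongrightarrow> 0"
proof -
  have "(\<lambda>n. exp (- Re z) ^ n) \<longlonglongrightarrow> 0"
    using z by (intro LIMSEQ_realpow_zero) auto
  then have "(\<lambda>n. exp (- (real n * Re z))) \<longlonglongrightarrow> 0"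
    by (simp add: exp_of_nat_mult[symmetric])
  from tendsto_mult_left_zero[OF this] show ?thesis .
qed

lemma laplace_upto_convergent:
  assumes z: "0 < Re z"
  shows "convergent (\<lambda>n. laplace_upto z (real n) x)"
proof -
  have "Cauchy (\<lambda>n. laplace_upto z (real n) x)"
    unfolding Cauchy_altdef
  proof (intro allI impI)
    fix e :: real assume "0 < e"
    from order_tendstoD(2)[OF laplace_tail_tendsto_0[OF z] this]
    obtain N where N: "\<And>n. N \<le> n \<Longrightarrow> exp (- (real n * Re z)) * (M * norm x / Re z) < e"
      unfolding eventually_sequentially by blast
    have "dist (laplace_upto z (real m) x) (laplace_upto z (real n) x) < e" if "N \<le> m" "m < n" for m n
      using N[OF that(1)] that(2) laplace_tail_bound[OF z, of "real m" "real n" x]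
        laplace_upto_diff[of "real m" "real n" z x]
      by (simp add: dist_norm norm_minus_commute[of "laplace_upto z (real m) x"])
    then show "\<exists>N. \<forall>m\<ge>N. \<forall>n>m. dist (laplace_upto z (real m) x) (laplace_upto z (real n) x) < e"
      by blast
  qed
  then show ?thesis by (rule Cauchy_convergent)
qed

text \<open>
  Applying the rescaled semigroup \<open>e\<^bsup>-hz\<^esup> T(h)\<close> shifts the interval of integration from \<open>[0, t]\<close> to
  \<open>[h, h + t]\<close>.
\<close>

lemma semigroup_laplace_upto:
  assumes h: "0 \<le> h" and t: "0 \<le> t"
  shows "exp (- (of_real h * z)) *\<^sub>C T h (laplace_upto z t x) = laplace_upto z (h + t) x - laplace_upto z h x"
proof -
  let ?f = "\<lambda>s. exp (- (of_real s * z)) *\<^sub>C T s x"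
  have "bounded_linear (\<lambda>y. exp (- (of_real h * z)) *\<^sub>C T h y)"
    by (intro bounded_linear_compose[OF bounded_linear_scaleC] blinfun.bounded_linear_right)
  from integral_linear[OF scaled_orbit_integrable[OF order_refl] this]
  have "exp (- (of_real h * z)) *\<^sub>C T h (laplace_upto z t x)
      = integral {0..t} (\<lambda>s. exp (- (of_real h * z)) *\<^sub>C T h (?f s))"
    by (simp add: laplace_upto_def o_def)
  also have "\<dots> = integral {0..t} (\<lambda>s. ?f (s + h))"
    using h by (intro integral_cong)
      (auto simp: semigroup_scaleC scaleC_scaleC exp_add[symmetric] semigroup_add[symmetric] algebra_simps)
  also have "\<dots> = integral {h..h + t} ?f"
    using integral_shift_real_ivl[of h h "h + t" ?f] by (simp add: add.commute)
  also have "\<dots> = laplace_upto z (h + t) x - laplace_upto z h x"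
    using laplace_upto_diff[of h "h + t"] h t by simp
  finally show ?thesis .
qed

lemma semigroup_laplace_upto_commute:
  assumes h: "0 \<le> h"
  shows "T h (laplace_upto z t x) = laplace_upto z t (T h x)"
proof -
  have "T h (laplace_upto z t x) = integral {0..t} (\<lambda>s. T h (exp (- (of_real s * z)) *\<^sub>C T s x))"
    unfolding laplace_upto_def
    by (rule integral_linear[OF scaled_orbit_integrable[OF order_refl] blinfun.bounded_linear_right,
          unfolded o_def, symmetric])
  also have "\<dots> = laplace_upto z t (T h x)"
    unfolding laplace_upto_def using h
    by (intro integral_cong)
      (auto simp: semigroup_scaleC semigroup_add[symmetric] add.commute)
  finally show ?thesis .
qed

lemma laplace_transform_exists:
  assumes z: "0 < Re z"
  shows "\<exists>R :: 'a \<Rightarrow>\<^sub>L 'a. R \<in> complex_blinfuns \<and> norm R \<le> M / Re z \<and>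
    (\<forall>x. (\<lambda>n. laplace_upto z (real n) x) \<longlonglongrightarrow> R x)"
proof -
  define r where "r x = lim (\<lambda>n. laplace_upto z (real n) x)" for x
  have r: "(\<lambda>n. laplace_upto z (real n) x) \<longlonglongrightarrow> r x" for x
    using laplace_upto_convergent[OF z] by (simp add: r_def convergent_LIMSEQ_iff)
  have add: "r (x + y) = r x + r y" for x y
    using tendsto_add[OF r r, of x y] r[of "x + y"]
    by (simp add: laplace_upto_linear LIMSEQ_unique)
  have scale: "r (c *\<^sub>C x) = c *\<^sub>C r x" for c x
    using tendsto_scaleC[OF tendsto_const r, of c x] r[of "c *\<^sub>C x"]
    by (simp add: laplace_upto_linear LIMSEQ_unique)
  have bound: "norm (r x) \<le> M / Re z * norm x" for x
    by (rule LIMSEQ_le_const2[OF tendsto_norm[OF r]])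
      (use laplace_upto_bound[OF z, of _ x] in auto)
  have "bounded_linear r"
    by (rule bounded_linear_intro[where K = "M / Re z"])
      (use add scale[of "of_real _"] bound in \<open>auto simp: scaleC_of_real mult.commute\<close>)
  then have app: "blinfun_apply (Blinfun r) = r"
    by (rule bounded_linear_Blinfun_apply)
  have "norm (Blinfun r) \<le> M / Re z"
    using bound z semigroup_bound_nonneg by (intro norm_blinfun_bound) (auto simp: app)
  with r scale show ?thesis
    by (intro exI[of _ "Blinfun r"]) (auto simp: app complex_blinfuns_def)
qed

context
  fixes z and R :: "'a \<Rightarrow>\<^sub>L 'a"
  assumes z: "0 < Re z"
    and R_lin: "R \<in> complex_blinfuns"
    and R: "\<And>x. (\<lambda>n. laplace_upto z (real n) x) \<longlonglongrightarrow> R x"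
begin

text \<open>
  The limit \<open>t \<rightarrow> \<infinity>\<close> of the shift identity for truncated transforms.  It says that the difference of the
  full and the truncated transform is a rescaled element of the orbit of \<open>R x\<close>, so that a bound for
  the resolvent bounds the tail of the Laplace integral.
\<close>

lemma semigroup_laplace_transform:
  assumes h: "0 \<le> h"
  shows "exp (- (of_real h * z)) *\<^sub>C T h (R x) = R x - laplace_upto z h x"
proof (rule LIMSEQ_unique)
  show "(\<lambda>n. exp (- (of_real h * z)) *\<^sub>C T h (laplace_upto z (real n) x))
      \<longlonglongrightarrow> exp (- (of_real h * z)) *\<^sub>C T h (R x)"
    by (intro tendsto_intros R)
  have "(\<lambda>n. laplace_upto z (h + real n) x - laplace_upto z (real n) x) \<longlonglongrightarrow> 0"
  proof (rule Lim_null_comparison[OF _ laplace_tail_tendsto_0[OF z, of x]], intro always_eventually allI)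
    show "norm (laplace_upto z (h + real n) x - laplace_upto z (real n) x)
        \<le> exp (- (real n * Re z)) * (M * norm x / Re z)" for n
      using laplace_tail_bound[OF z, of "real n" "h + real n" x] laplace_upto_diff[of "real n" "h + real n"] h
      by simp
  qed
  from tendsto_add[OF this R[of x]] have "(\<lambda>n. laplace_upto z (h + real n) x) \<longlonglongrightarrow> R x"
    by simp
  then show "(\<lambda>n. exp (- (of_real h * z)) *\<^sub>C T h (laplace_upto z (real n) x))
      \<longlonglongrightarrow> R x - laplace_upto z h x"
    using h by (simp add: semigroup_laplace_upto tendsto_diff)
qed

lemma semigroup_commute_laplace_transform:
  assumes "0 \<le> h"
  shows "T h (R x) = R (T h x)"
proof (rule LIMSEQ_unique)
  show "(\<lambda>n. T h (laplace_upto z (real n) x)) \<longlonglongrightarrow> T h (R x)"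
    by (intro tendsto_intros R)
  show "(\<lambda>n. T h (laplace_upto z (real n) x)) \<longlonglongrightarrow> R (T h x)"
    using R by (simp add: semigroup_laplace_upto_commute[OF assms])
qed

text \<open>
  The preceding identity reads \<open>T(h) R x = e\<^bsup>hz\<^esup> (R x - V(h) x)\<close>, where \<open>V(h)\<close> is the transform truncated at
  \<open>h\<close>.  The right-hand side has derivative \<open>z R x - x\<close> at \<open>h = 0\<close>.
\<close>

lemma laplace_transform_in_generator: "(R x, z *\<^sub>C R x - x) \<in> generator T"
proof -
  let ?V = "\<lambda>h. laplace_upto z h x"
  have V: "(?V has_vector_derivative x) (at 0 within {0..1})"
    using integral_has_vector_derivative[OF continuous_on_subset[OF scaled_orbit_continuous_on], of 0 1 0 z x]
    by (simp add: laplace_upto_def)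
  have "((\<lambda>h. exp (of_real h * z)) has_vector_derivative z) (at 0 within {0..1})"
    by (rule has_vector_derivative_real_field[where f = "\<lambda>w. exp (w * z)"])
      (auto intro!: derivative_eq_intros)
  from has_vector_derivative_scaleC[OF this has_vector_derivative_diff[OF has_vector_derivative_const V, of "R x"]]
  have "((\<lambda>h. exp (of_real h * z) *\<^sub>C (R x - ?V h)) has_vector_derivative z *\<^sub>C R x - x) (at 0 within {0..1})"
    using scaleC_add_right[of 1 x "- x"] by (simp add: laplace_upto_def)
  then have "((\<lambda>h. T h (R x)) has_vector_derivative z *\<^sub>C R x - x) (at 0 within {0..1})"
  proof (rule has_vector_derivative_transform[rotated 2])
    fix h :: real assume "h \<in> {0..1}"
    then show "T h (R x) = exp (of_real h * z) *\<^sub>C (R x - ?V h)"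
      by (simp add: semigroup_laplace_transform[symmetric] scaleC_scaleC exp_add[symmetric])
  qed auto
  then have "((\<lambda>h. (T h (R x) - R x - h *\<^sub>R (z *\<^sub>C R x - x)) /\<^sub>R norm h) \<longlongrightarrow> 0) (at_right 0)"
    by (simp add: has_vector_derivative_def has_derivative_at_within at_within_Icc_at_right)
  then have "((\<lambda>h. (T h (R x) - R x) /\<^sub>R h - (z *\<^sub>C R x - x)) \<longlongrightarrow> 0) (at_right 0)"
    by (rule Lim_transform_eventually) (auto simp: eventually_at_filter scaleR_diff_right)
  then show ?thesis
    by (simp add: generator_def LIM_zero_iff)
qed

text \<open>
  \<open>R\<close> commutes with the semigroup, so \<open>R w\<close> is the derivative at 0 of the orbit of \<open>R x\<close>, which is
  \<open>z R x - x\<close>.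
\<close>

lemma laplace_transform_inverse:
  assumes xw: "(x, w) \<in> generator T"
  shows "R (z *\<^sub>C x - w) = x"
proof -
  have "((\<lambda>h. R ((T h x - x) /\<^sub>R h)) \<longlongrightarrow> R w) (at_right 0)"
    using xw by (intro tendsto_intros) (simp add: generator_def)
  moreover have "\<forall>\<^sub>F h in at_right 0. R ((T h x - x) /\<^sub>R h) = (T h (R x) - R x) /\<^sub>R h"
    using eventually_at_right_less[of 0]
    by eventually_elim (simp add: blinfun.scaleR_right blinfun.diff_right semigroup_commute_laplace_transform)
  ultimately have "((\<lambda>h. (T h (R x) - R x) /\<^sub>R h) \<longlongrightarrow> R w) (at_right 0)"
    by (rule Lim_transform_eventually)
  moreover have "((\<lambda>h. (T h (R x) - R x) /\<^sub>R h) \<longlongrightarrow> z *\<^sub>C R x - x) (at_right 0)"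
    using laplace_transform_in_generator[of x] by (simp add: generator_def)
  ultimately have "R w = z *\<^sub>C R x - x"
    by (intro tendsto_unique[OF trivial_limit_at_right_real])
  then show ?thesis
    using R_lin by (simp add: blinfun.diff_right complex_blinfuns_def)
qed

lemma resolvent_eq_laplace_transform: "resolvent z (generator T) = R"
proof -
  have graph: "{(y, x). x = blinfun_apply R y} = {(z *\<^sub>C x - w, x) | x w. (x, w) \<in> generator T}"
  proof (intro equalityI subsetI)
    fix p assume "p \<in> {(y, x). x = blinfun_apply R y}"
    then obtain y where p: "p = (y, R y)" by auto
    have "y = z *\<^sub>C R y - (z *\<^sub>C R y - y)" by simp
    with laplace_transform_in_generator[of y]
    show "p \<in> {(z *\<^sub>C x - w, x) | x w. (x, w) \<in> generator T}"
      unfolding p by blast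
  qed (auto simp: laplace_transform_inverse)
  show ?thesis
    unfolding resolvent_def graph[symmetric]
    by (rule the_equality) (auto intro!: blinfun_eqI simp: set_eq_iff)
qed

end

theorem resolvent_properties:
  assumes z: "0 < Re z"
  shows "norm (resolvent z (generator T)) \<le> M / Re z"
    and "0 \<le> t \<Longrightarrow> exp (- (of_real t * z)) *\<^sub>C T t (resolvent z (generator T) x)
      = resolvent z (generator T) x - laplace_upto z t x"
proof -
  obtain R :: "'a \<Rightarrow>\<^sub>L 'a" where R: "R \<in> complex_blinfuns" "norm R \<le> M / Re z"
    "\<And>x. (\<lambda>n. laplace_upto z (real n) x) \<longlonglongrightarrow> R x"
    using laplace_transform_exists[OF z] by blast
  note eq = resolvent_eq_laplace_transform[OF z R(1,3)]
  show "norm (resolvent z (generator T)) \<le> M / Re z"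
    using R(2) by (simp add: eq)
  show "0 \<le> t \<Longrightarrow> exp (- (of_real t * z)) *\<^sub>C T t (resolvent z (generator T) x)
      = resolvent z (generator T) x - laplace_upto z t x"
    unfolding eq by (rule semigroup_laplace_transform[OF z R(1,3)])
qed

end

end

section \<open>Norming functionals\<close>

definition sublinear :: "('a::real_vector \<Rightarrow> real) \<Rightarrow> bool"
  where "sublinear p \<longleftrightarrow>
    (\<forall>x y. p (x + y) \<le> p x + p y) \<and> (\<forall>r x. 0 \<le> r \<longrightarrow> p (r *\<^sub>R x) = r * p x)"

lemma sublinearD:
  assumes "sublinear p"
  shows "p (x + y) \<le> p x + p y" "0 \<le> r \<Longrightarrow> p (r *\<^sub>R x) = r * p x" "p 0 = 0" "- p (- x) \<le> p x"
proof -
  show *: "p (x + y) \<le> p x + p y" for x y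
    using assms by (auto simp: sublinear_def)
  show "0 \<le> r \<Longrightarrow> p (r *\<^sub>R x) = r * p x"
    using assms by (auto simp: sublinear_def)
  have "p (0 *\<^sub>R x) = 0 * p x"
    using assms unfolding sublinear_def by blast
  then show 0: "p 0 = 0" by simp
  show "- p (- x) \<le> p x"
    using *[of x "- x"] 0 by simp
qed

text \<open>
  The bounds \<open>hom\<close> and \<open>add\<close> may move to another index because the functionals
  \<open>x \<mapsto> p (x + s *\<^sub>R y) - s * p y\<close> with fixed \<open>s\<close>, to which the lemma is applied, are in general not
  homogeneous.  Scaling back by the inverse factor turns the inequality for the infimum that results from
  \<open>hom\<close> into an equation.
\<close>

lemma sublinear_INF:
  fixes p :: "'i \<Rightarrow> 'a::real_vector \<Rightarrow> real"
  assumes ne: "I \<noteq> {}"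
    and bdd: "\<And>x. bdd_below ((\<lambda>i. p i x) ` I)"
    and hom: "\<And>i r x. i \<in> I \<Longrightarrow> 0 < r \<Longrightarrow> \<exists>j\<in>I. p j (r *\<^sub>R x) \<le> r * p i x"
    and zero: "\<And>i. i \<in> I \<Longrightarrow> p i 0 = 0"
    and add: "\<And>i j x y. i \<in> I \<Longrightarrow> j \<in> I \<Longrightarrow> \<exists>k\<in>I. p k (x + y) \<le> p i x + p j y"
  shows "sublinear (\<lambda>x. INF i\<in>I. p i x)"
proof -
  let ?q = "\<lambda>x. INF i\<in>I. p i x"
  have le: "?q x \<le> p i x" if "i \<in> I" for i x
    by (rule cINF_lower[OF bdd that])
  have sub: "?q (x + y) \<le> ?q x + ?q y" for x y
  proof -
    have "?q (x + y) - p i x \<le> p j y" if ij: "i \<in> I" "j \<in> I" for i j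
    proof -
      obtain k where "k \<in> I" "p k (x + y) \<le> p i x + p j y"
        using add[OF ij] by blast
      with le[of k "x + y"] show ?thesis by simp
    qed
    then have "?q (x + y) - p i x \<le> ?q y" if "i \<in> I" for i
      using that ne by (intro cINF_greatest) auto
    then have "?q (x + y) - ?q y \<le> p i x" if "i \<in> I" for i
      using that by (simp add: algebra_simps)
    then have "?q (x + y) - ?q y \<le> ?q x"
      using ne by (intro cINF_greatest) auto
    then show ?thesis by simp
  qed
  have le_hom: "?q (r *\<^sub>R x) \<le> r * ?q x" if "0 < r" for r x
  proof -
    have "?q (r *\<^sub>R x) / r \<le> p i x" if i: "i \<in> I" for i
    proof -
      obtain j where j: "j \<in> I" "p j (r *\<^sub>R x) \<le> r * p i x"
        using hom i \<open>0 < r\<close> by blast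
      have "?q (r *\<^sub>R x) \<le> r * p i x"
        using le[OF j(1), of "r *\<^sub>R x"] j(2) by linarith
      then show ?thesis
        using \<open>0 < r\<close> by (simp add: field_simps)
    qed
    then have "?q (r *\<^sub>R x) / r \<le> ?q x"
      using ne by (intro cINF_greatest) auto
    then show ?thesis
      using \<open>0 < r\<close> by (simp add: field_simps)
  qed
  have "?q (r *\<^sub>R x) = r * ?q x" if "0 \<le> r" for r x
  proof (cases "r = 0")
    case True
    have "(\<lambda>i. p i 0) ` I = {0}"
      using zero ne by auto
    with True show ?thesis by simp
  next
    case False
    with that have "0 < r" by simp
    have "?q (inverse r *\<^sub>R r *\<^sub>R x) \<le> inverse r * ?q (r *\<^sub>R x)"
      using \<open>0 < r\<close> by (intro le_hom) auto
    then have "r * ?q x \<le> ?q (r *\<^sub>R x)"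
      using \<open>0 < r\<close> by (simp add: field_simps)
    with le_hom[OF \<open>0 < r\<close>, of x] show ?thesis by simp
  qed
  with sub show ?thesis
    unfolding sublinear_def by blast
qed

text \<open>
  The functional is \<open>q x = (INF s\<in>{0..}. p (x + s *\<^sub>R y) - s * p y)\<close>.  The parameters \<open>s = 0\<close> and
  \<open>s = 1\<close> give the two upper bounds, and by subadditivity \<open>- p (- x)\<close> bounds the infimum from below.
  If \<open>q = p\<close>, the second bound says that \<open>p\<close> is superadditive in the direction \<open>y\<close>.
\<close>

lemma sublinear_drop_along:
  assumes p: "sublinear p"
  shows "\<exists>q. sublinear q \<and> (\<forall>x. q x \<le> p x) \<and> (\<forall>x. q x \<le> p (x + y) - p y)"
proof -
  let ?f = "\<lambda>s x. p (x + s *\<^sub>R y) - s * p y"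
  let ?q = "\<lambda>x. INF s\<in>{0..}. ?f s x"
  have bd: "- p (- x) \<le> ?f s x" if "0 \<le> s" for s x
    using sublinearD(1)[OF p, of "x + s *\<^sub>R y" "- x"] sublinearD(2)[OF p that, of y] by simp
  have bdd: "bdd_below ((\<lambda>s. ?f s x) ` {0..})" for x
    using bd by (intro bdd_belowI2) auto
  have "sublinear ?q"
  proof (rule sublinear_INF[OF _ bdd])
    fix s r :: real and x
    assume s: "s \<in> {0..}" and r: "0 < r"
    have "?f (r * s) (r *\<^sub>R x) = r * ?f s x"
      using sublinearD(2)[OF p, of r "x + s *\<^sub>R y"] r by (simp add: algebra_simps)
    with s r show "\<exists>j\<in>{0..}. ?f j (r *\<^sub>R x) \<le> r * ?f s x"
      by (intro bexI[of _ "r * s"]) auto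
  next
    fix s t :: real and x x'
    assume "s \<in> {0..}" "t \<in> {0..}"
    then show "\<exists>k\<in>{0..}. ?f k (x + x') \<le> ?f s x + ?f t x'"
      using sublinearD(1)[OF p, of "x + s *\<^sub>R y" "x' + t *\<^sub>R y"]
      by (intro bexI[of _ "s + t"]) (auto simp: algebra_simps)
  qed (use sublinearD[OF p] in auto)
  moreover have "?q x \<le> ?f 0 x" "?q x \<le> ?f 1 x" for x
    by (rule cINF_lower[OF bdd]; simp)+
  ultimately show ?thesis
    by (intro exI[of _ ?q]) simp
qed

text \<open>
  Zorn's lemma applies because the pointwise infimum of a chain of sublinear functionals below \<open>p\<close>
  is again sublinear: for two members of the chain, the smaller one serves for both summands, and
  \<open>- p (- x)\<close> keeps the infimum finite.
\<close>

lemma minimal_sublinear: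
  assumes p: "sublinear p"
  shows "\<exists>m. sublinear m \<and> (\<forall>x. m x \<le> p x) \<and> (\<forall>q. sublinear q \<longrightarrow> q \<le> m \<longrightarrow> q = m)"
proof -
  define A where "A = {q. sublinear q \<and> q \<le> p}"
  have "\<exists>m\<in>A. \<forall>a\<in>A. a \<le> m \<longrightarrow> a = m"
  proof (rule predicate_Zorn)
    show "partial_order_on A (relation_of (\<lambda>m a. a \<le> m) A)"
      by (auto intro!: partial_order_on_relation_ofI)
  next
    fix C assume C: "C \<in> Chains (relation_of (\<lambda>m a. a \<le> m) A)"
    then have CA: "C \<subseteq> A" and tot: "\<And>f g. f \<in> C \<Longrightarrow> g \<in> C \<Longrightarrow> f \<le> g \<or> g \<le> f"
      by (auto simp: Chains_def relation_of_def)
    show "\<exists>u\<in>A. \<forall>a\<in>C. u \<le> a"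
    proof (cases "C = {}")
      case True
      with p show ?thesis by (auto simp: A_def intro!: bexI[of _ p])
    next
      case False
      let ?u = "\<lambda>x. INF f\<in>C. f x"
      have sl: "sublinear f" and le: "f \<le> p" if "f \<in> C" for f
        using CA that by (auto simp: A_def)
      have bdd: "bdd_below ((\<lambda>f. f x) ` C)" for x
      proof (rule bdd_belowI2)
        fix f assume f: "f \<in> C"
        show "- p (- x) \<le> f x"
          using sublinearD(4)[OF sl[OF f], of x] le_funD[OF le[OF f], of "- x"] by linarith
      qed
      have "sublinear ?u"
      proof (rule sublinear_INF[OF False bdd])
        fix f g :: "'a \<Rightarrow> real" and x y
        assume f: "f \<in> C" and g: "g \<in> C"
        then consider "f \<le> g" | "g \<le> f" using tot by blast
        then show "\<exists>k\<in>C. k (x + y) \<le> f x + g y"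
        proof cases
          case 1
          then show ?thesis
            using sublinearD(1)[OF sl[OF f], of x y] le_funD[OF 1, of y] f
            by (intro bexI[of _ f]) auto
        next
          case 2
          then show ?thesis
            using sublinearD(1)[OF sl[OF g], of x y] le_funD[OF 2, of x] g
            by (intro bexI[of _ g]) auto
        qed
      qed (use sublinearD(2,3)[OF sl] in \<open>auto intro: order_eq_refl\<close>)
      moreover have "?u \<le> f" if "f \<in> C" for f
        by (rule le_funI, rule cINF_lower[OF bdd that])
      ultimately show ?thesis
        using False le unfolding A_def by (intro bexI[of _ ?u]) (auto intro: order_trans)
    qed
  qed
  then obtain m where m: "m \<in> A" "\<And>a. a \<in> A \<Longrightarrow> a \<le> m \<Longrightarrow> a = m" by blast
  have "q = m" if "sublinear q" "q \<le> m" for q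
    using m that by (auto simp: A_def intro: order_trans)
  with m(1) show ?thesis
    by (auto simp: A_def le_fun_def)
qed

text \<open>
  A minimal sublinear functional \<open>m\<close> is linear, since lowering it along any \<open>y\<close> changes nothing and
  so \<open>m (x + y) \<ge> m x + m y\<close>.  To reach the value \<open>p v\<close> at \<open>v\<close>, the functional \<open>p\<close> is lowered along
  \<open>v\<close> first: this forces \<open>m (- v) \<le> - p v\<close>.
\<close>

theorem Hahn_Banach_sublinear:
  fixes p :: "'a::real_vector \<Rightarrow> real"
  assumes p: "sublinear p"
  shows "\<exists>f. linear f \<and> (\<forall>x. f x \<le> p x) \<and> f v = p v"
proof -
  obtain q where q: "sublinear q" "\<And>x. q x \<le> p x" "\<And>x. q x \<le> p (x + v) - p v"
    using sublinear_drop_along[OF p, of v] by blast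
  obtain m where m: "sublinear m" "\<And>x. m x \<le> q x" "\<And>r. sublinear r \<Longrightarrow> r \<le> m \<Longrightarrow> r = m"
    using minimal_sublinear[OF q(1)] by blast
  have add: "m (x + y) = m x + m y" for x y
  proof -
    obtain r where r: "sublinear r" "\<And>x. r x \<le> m x" "\<And>x. r x \<le> m (x + y) - m y"
      using sublinear_drop_along[OF m(1), of y] by blast
    then have "r = m" using m(3) by (simp add: le_fun_def)
    with r(3)[of x] sublinearD(1)[OF m(1), of x y] show ?thesis by simp
  qed
  have neg: "m (- x) = - m x" for x
    using add[of x "- x"] sublinearD(3)[OF m(1)] by simp
  have "linear m"
  proof (rule linearI[OF add])
    fix r x
    show "m (r *\<^sub>R x) = r *\<^sub>R m x"
    proof (cases "0 \<le> r")
      case False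
      then have "m ((- r) *\<^sub>R (- x)) = (- r) * m (- x)"
        by (intro sublinearD(2)[OF m(1)]) simp
      then show ?thesis by (simp add: neg)
    qed (simp add: sublinearD(2)[OF m(1)])
  qed
  moreover have "m x \<le> p x" for x
    using m(2) q(2) order_trans by blast
  moreover have "p v \<le> m v"
    using m(2)[of "- v"] q(3)[of "- v"] neg[of v] sublinearD(3)[OF p] by simp
  ultimately show ?thesis
    by (meson order_antisym)
qed

text \<open>
  The complexification \<open>x \<mapsto> f x - \<i> f (\<i> x)\<close> of a real norming functional \<open>f\<close>.  Estimating real and
  imaginary part separately costs the factor 2, which only enters the constants.
\<close>

lemma exists_norming_functional:
  fixes v :: "'a::complex_normed_vector"
  shows "\<exists>\<phi> :: 'a \<Rightarrow> complex. bounded_linear \<phi> \<and> (\<forall>c x. \<phi> (c *\<^sub>C x) = c * \<phi> x) \<and>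
    (\<forall>x. cmod (\<phi> x) \<le> 2 * norm x) \<and> norm v \<le> cmod (\<phi> v)"
proof -
  have "sublinear (norm :: 'a \<Rightarrow> real)"
    by (auto simp: sublinear_def norm_triangle_ineq)
  then obtain f :: "'a \<Rightarrow> real"
    where f: "linear f" "\<And>x. f x \<le> norm x" "f v = norm v"
    using Hahn_Banach_sublinear by blast
  interpret f: linear f by fact
  have abs_f: "\<bar>f x\<bar> \<le> norm x" for x
    using f(2)[of x] f(2)[of "- x"] by (simp add: f.neg)
  define \<phi> where "\<phi> x = Complex (f x) (- f (\<i> *\<^sub>C x))" for x
  have add: "\<phi> (x + y) = \<phi> x + \<phi> y" for x y
    by (simp add: \<phi>_def scaleC_add_right f.add complex_eq_iff)
  have scR: "\<phi> (r *\<^sub>R x) = r *\<^sub>R \<phi> x" for r x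
    by (simp add: \<phi>_def scaleC_scaleR f.scale complex_eq_iff)
  have mi: "\<phi> (\<i> *\<^sub>C x) = \<i> * \<phi> x" for x
  proof -
    have "\<i> *\<^sub>C \<i> *\<^sub>C x = - x"
      using scaleC_of_real[of "-1" x] by (simp add: scaleC_scaleC)
    then show ?thesis
      by (simp add: \<phi>_def f.neg complex_eq_iff)
  qed
  have scC: "\<phi> (c *\<^sub>C x) = c * \<phi> x" for c x
  proof -
    have "c *\<^sub>C x = Re c *\<^sub>R x + Im c *\<^sub>R \<i> *\<^sub>C x"
      by (subst complex_eq[of c])
        (simp add: scaleC_add_left scaleC_of_real scaleC_scaleC[symmetric] scaleC_scaleR)
    then have "\<phi> (c *\<^sub>C x) = Re c *\<^sub>R \<phi> x + Im c *\<^sub>R (\<i> * \<phi> x)"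
      by (simp only: add scR mi)
    then show ?thesis
      by (simp add: complex_eq_iff)
  qed
  have bound: "cmod (\<phi> x) \<le> 2 * norm x" for x
  proof -
    have "cmod (\<phi> x) \<le> \<bar>f x\<bar> + \<bar>f (\<i> *\<^sub>C x)\<bar>"
      using cmod_le[of "\<phi> x"] by (simp add: \<phi>_def)
    also have "\<dots> \<le> norm x + norm (\<i> *\<^sub>C x)"
      by (intro add_mono abs_f)
    finally show ?thesis by (simp add: norm_scaleC)
  qed
  have "bounded_linear \<phi>"
    by (rule bounded_linear_intro[where K = 2]) (use add scR bound in \<open>auto simp: mult.commute\<close>)
  moreover have "norm v \<le> cmod (\<phi> v)"
    using abs_Re_le_cmod[of "\<phi> v"] f(3) by (simp add: \<phi>_def)
  ultimately show ?thesis
    using scC bound by blast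
qed

section \<open>Newman's contour estimate\<close>

lemma norm_add3_le:
  fixes x y z :: "'a::real_normed_vector"
  assumes "norm x \<le> a" "norm y \<le> b" "norm z \<le> c"
  shows "norm (x + y + z) \<le> a + b + c"
  using assms norm_triangle_ineq[of "x + y" z] norm_triangle_ineq[of x y] by linarith

lemma has_contour_integral_rectpath_sides:
  assumes "continuous_on (path_image (rectpath a c)) f"
    and "b = Complex (Re c) (Im a)" "d = Complex (Re a) (Im c)"
    and "(f has_contour_integral I) (rectpath a c)"
  shows "I = contour_integral (linepath a b) f + contour_integral (linepath b c) f
           + contour_integral (linepath c d) f + contour_integral (linepath d a) f"
proof -
  have segs: "path_image (rectpath a c) =
      closed_segment a b \<union> closed_segment b c \<union> closed_segment c d \<union> closed_segment d a"
    unfolding rectpath_def Let_def assms(2,3) by (simp add: path_image_join Un_assoc)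
  have int: "f contour_integrable_on linepath a b" "f contour_integrable_on linepath b c"
    "f contour_integrable_on linepath c d" "f contour_integrable_on linepath d a"
    by (rule contour_integrable_continuous_linepath,
        rule continuous_on_subset[OF assms(1)], auto simp: segs)+
  have "(f has_contour_integral (contour_integral (linepath a b) f
      + (contour_integral (linepath b c) f + (contour_integral (linepath c d) f
      + contour_integral (linepath d a) f)))) (rectpath a c)"
    unfolding rectpath_def Let_def assms(2)[symmetric] assms(3)[symmetric]
    by (intro has_contour_integral_join has_contour_integral_integral int) auto
  from has_contour_integral_unique[OF assms(4) this] show ?thesis
    by (simp add: add.assoc)
qed

lemma Cauchy_formula_rectpath:
  assumes f: "f holomorphic_on S" and S: "convex S" "open S" "cbox a c \<subseteq> S" and z: "z \<in> box a c"
  shows "((\<lambda>w. f w / (w - z)) has_contour_integral (2 * pi * \<i> * f z)) (rectpath a c)"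
    and "continuous_on (path_image (rectpath a c)) (\<lambda>w. f w / (w - z))"
proof -
  have le: "Re a \<le> Re c" "Im a \<le> Im c"
    using z by (auto simp: in_box_complex_iff)
  have img: "path_image (rectpath a c) \<subseteq> S - {z}"
    using path_image_rectpath_cbox_minus_box[OF le] S(3) z by auto
  have "z \<in> S"
    using z S(3) box_subset_cbox by blast
  then show "((\<lambda>w. f w / (w - z)) has_contour_integral (2 * pi * \<i> * f z)) (rectpath a c)"
    using Cauchy_integral_formula_convex_simple[OF S(1) f _ _ img] S(2) winding_number_rectpath[OF z]
    by (simp add: interior_open)
  have "continuous_on (S - {z}) (\<lambda>w. f w / (w - z))"
    using holomorphic_on_imp_continuous_on[OF f]
    by (intro continuous_intros) (auto intro: continuous_on_subset)
  then show "continuous_on (path_image (rectpath a c)) (\<lambda>w. f w / (w - z))"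
    using img by (rule continuous_on_subset)
qed

text \<open>
  The zero of order \<open>k\<close> at \<open>\<plusminus>\<i>R\<close> has two uses: a single power compensates the singularity
  \<open>1 / \<bar>Re z\<bar>\<close> of the bounds for the Laplace transforms at the imaginary axis, and the high power makes the kernel so
  small near \<open>\<plusminus>\<i>R\<close> that polynomial growth of the transform does no harm there.
\<close>

definition newman_kernel :: "real \<Rightarrow> nat \<Rightarrow> complex \<Rightarrow> complex"
  where "newman_kernel R k z = (1 + z\<^sup>2 / (of_real R)\<^sup>2) ^ k"

lemma newman_kernel_bound:
  assumes R: "0 < R" and z: "\<bar>Re z\<bar> \<le> R" "\<bar>Im z\<bar> \<le> R"
  shows "cmod (newman_kernel R k z) \<le> 3 ^ k"
proof -
  have "(cmod z)\<^sup>2 \<le> R\<^sup>2 + R\<^sup>2"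
    unfolding cmod_power2 using z by (intro add_mono) (auto simp: abs_le_square_iff[symmetric])
  then have "cmod (z\<^sup>2 / (of_real R)\<^sup>2) \<le> 2"
    using R by (simp add: norm_divide norm_power field_simps)
  then have "cmod (1 + z\<^sup>2 / (of_real R)\<^sup>2) \<le> 3"
    using norm_triangle_ineq[of 1 "z\<^sup>2 / (of_real R)\<^sup>2"] by simp
  then show ?thesis
    by (simp add: newman_kernel_def norm_power power_mono)
qed

text \<open>
  For \<open>z = x + \<i>y\<close> with \<open>y\<^sup>2 = R\<^sup>2\<close>, the term \<open>1\<close> cancels and \<open>1 + z\<^sup>2 / R\<^sup>2 = x (x + 2 \<i>y) / R\<^sup>2\<close>.
\<close>

lemma newman_kernel_bound_horizontal:
  assumes R: "0 < R" and z: "\<bar>Re z\<bar> \<le> R" "\<bar>Im z\<bar> = R"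
  shows "cmod (newman_kernel R k z) \<le> (3 * \<bar>Re z\<bar> / R) ^ k"
proof -
  have "(Im z)\<^sup>2 = R\<^sup>2"
    using z(2) R by (metis power2_abs)
  then have "1 + z\<^sup>2 / (of_real R)\<^sup>2 = of_real (Re z / R\<^sup>2) * (of_real (Re z) + 2 * of_real (Im z) * \<i>)"
    using R by (simp add: complex_eq_iff power2_eq_square field_simps)
  also have "cmod \<dots> \<le> \<bar>Re z\<bar> / R\<^sup>2 * (R + 2 * R)"
    unfolding norm_mult
  proof (intro mult_mono)
    show "cmod (complex_of_real (Re z) + 2 * complex_of_real (Im z) * \<i>) \<le> R + 2 * R"
      using z by (intro norm_triangle_le) (auto simp: norm_mult)
  qed (use R in \<open>auto simp: norm_divide norm_power\<close>)
  also have "\<dots> = 3 * \<bar>Re z\<bar> / R"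
    using R by (simp add: power2_eq_square field_simps)
  finally show ?thesis
    unfolding newman_kernel_def norm_power by (intro power_mono) auto
qed

text \<open>
  On the boundary of the square \<open>[-R, R]\<^sup>2\<close> the kernel is at most \<open>3\<^sup>k \<bar>Re z\<bar> / R\<close>, which absorbs the
  singularity of the bound for \<open>p\<close>, and \<open>\<bar>z - 1\<bar> \<ge> R / 2\<close>.  On the imaginary axis itself the kernel vanishes.
\<close>

lemma newman_integrand_bound:
  assumes R: "2 \<le> R" and k: "1 \<le> k" and K: "0 \<le> K"
    and z: "\<bar>Re z\<bar> = R \<and> \<bar>Im z\<bar> \<le> R \<or> \<bar>Re z\<bar> \<le> R \<and> \<bar>Im z\<bar> = R"
    and p: "Re z \<noteq> 0 \<Longrightarrow> cmod p \<le> K / \<bar>Re z\<bar>"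
  shows "cmod (p * newman_kernel R k z / (z - 1)) \<le> 2 * 3 ^ k * K / R\<^sup>2"
proof (cases "Re z = 0")
  case True
  with z R have "cmod (newman_kernel R k z) \<le> (3 * \<bar>Re z\<bar> / R) ^ k"
    by (intro newman_kernel_bound_horizontal) auto
  with True k have "newman_kernel R k z = 0" by (simp add: power_0_left)
  with K show ?thesis by simp
next
  case False
  have dist: "R / 2 \<le> cmod (z - 1)"
    using z
  proof
    assume "\<bar>Re z\<bar> = R \<and> \<bar>Im z\<bar> \<le> R"
    with R abs_Re_le_cmod[of "z - 1"] show ?thesis
      unfolding minus_complex.sel one_complex.sel by linarith
  next
    assume "\<bar>Re z\<bar> \<le> R \<and> \<bar>Im z\<bar> = R"
    with R abs_Im_le_cmod[of "z - 1"] show ?thesis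
      unfolding minus_complex.sel one_complex.sel by linarith
  qed
  have ker: "cmod (newman_kernel R k z) \<le> 3 ^ k * \<bar>Re z\<bar> / R"
    using z
  proof
    assume "\<bar>Re z\<bar> = R \<and> \<bar>Im z\<bar> \<le> R"
    with R newman_kernel_bound[of R z k] show ?thesis by simp
  next
    assume *: "\<bar>Re z\<bar> \<le> R \<and> \<bar>Im z\<bar> = R"
    with R have "cmod (newman_kernel R k z) \<le> (3 * \<bar>Re z\<bar> / R) ^ k"
      by (intro newman_kernel_bound_horizontal) auto
    also have "\<dots> = 3 ^ k * (\<bar>Re z\<bar> / R) ^ k"
      by (simp add: power_mult_distrib power_divide)
    also have "(\<bar>Re z\<bar> / R) ^ k \<le> \<bar>Re z\<bar> / R"
      using * R k power_decreasing[of 1 k "\<bar>Re z\<bar> / R"] by simp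
    finally show ?thesis by simp
  qed
  have "cmod (p * newman_kernel R k z / (z - 1))
      \<le> K / \<bar>Re z\<bar> * (3 ^ k * \<bar>Re z\<bar> / R) / (R / 2)"
    unfolding norm_divide norm_mult
    using p[OF False] ker dist R K by (intro frac_le mult_mono) auto
  also have "\<dots> = 2 * 3 ^ k * K / R\<^sup>2"
    using False R by (simp add: power2_eq_square field_simps)
  finally show ?thesis .
qed

text \<open>
  The case \<open>s = R\<close> is the right half of the boundary of the square and the case \<open>s = - R\<close> is the left
  half, both traversed from \<open>-\<i>R\<close> to \<open>\<i>R\<close>.  The integrand is \<open>O(1 / R\<^sup>2)\<close> on a path of length \<open>4 R\<close>.
\<close>

lemma contour_integral_bound_half_square:
  assumes R: "2 \<le> R" and k: "1 \<le> k" and K: "0 \<le> K" and s: "s = R \<or> s = - R"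
    and cont: "continuous_on (closed_segment (Complex 0 (- R)) (Complex s (- R)) \<union>
        closed_segment (Complex s (- R)) (Complex s R) \<union>
        closed_segment (Complex s R) (Complex 0 R)) (\<lambda>z. p z * newman_kernel R k z / (z - 1))"
    and p: "\<And>z. 0 < Re z * s \<Longrightarrow> \<bar>Re z\<bar> \<le> R \<Longrightarrow> \<bar>Im z\<bar> \<le> R \<Longrightarrow> cmod (p z) \<le> K / \<bar>Re z\<bar>"
  shows "cmod (
        contour_integral (linepath (Complex 0 (- R)) (Complex s (- R)))
          (\<lambda>z. p z * newman_kernel R k z / (z - 1))
      + contour_integral (linepath (Complex s (- R)) (Complex s R))
          (\<lambda>z. p z * newman_kernel R k z / (z - 1))
      + contour_integral (linepath (Complex s R) (Complex 0 R))
          (\<lambda>z. p z * newman_kernel R k z / (z - 1)))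
    \<le> 8 * 3 ^ k * K / R"
proof -
  let ?f = "\<lambda>z. p z * newman_kernel R k z / (z - 1)"
  let ?B = "2 * 3 ^ k * K / R\<^sup>2"
  let ?J = "\<lambda>a b. contour_integral (linepath a b) ?f"
  have seg: "(\<bar>Re z\<bar> = R \<and> \<bar>Im z\<bar> \<le> R \<or> \<bar>Re z\<bar> \<le> R \<and> \<bar>Im z\<bar> = R) \<and> 0 \<le> Re z * s"
    if "z \<in> closed_segment (Complex 0 (- R)) (Complex s (- R)) \<union>
        closed_segment (Complex s (- R)) (Complex s R) \<union>
        closed_segment (Complex s R) (Complex 0 R)" for z
    using that s R
    by (auto simp: closed_segment_same_Im closed_segment_same_Re closed_segment_eq_real_ivl
        intro: mult_nonpos_nonneg split: if_splits)
  have bound: "cmod (?f z) \<le> ?B"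
    if "z \<in> closed_segment (Complex 0 (- R)) (Complex s (- R)) \<union>
        closed_segment (Complex s (- R)) (Complex s R) \<union>
        closed_segment (Complex s R) (Complex 0 R)" for z
  proof (rule newman_integrand_bound[OF R k K])
    assume "Re z \<noteq> 0"
    then have "0 < Re z * s" using seg[OF that] s R by (auto simp: less_le)
    then show "cmod (p z) \<le> K / \<bar>Re z\<bar>"
      using seg[OF that] by (intro p) auto
  qed (use seg[OF that] in auto)
  have side: "cmod (contour_integral (linepath a b) ?f) \<le> ?B * cmod (b - a)"
    if "closed_segment a b \<subseteq> closed_segment (Complex 0 (- R)) (Complex s (- R)) \<union>
        closed_segment (Complex s (- R)) (Complex s R) \<union>
        closed_segment (Complex s R) (Complex 0 R)" for a b
    using that bound K R continuous_on_subset[OF cont that]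
    by (intro contour_integral_bound_linepath contour_integrable_continuous_linepath) auto
  have len: "cmod (Complex s (- R) - Complex 0 (- R)) = R" "cmod (Complex 0 R - Complex s R) = R"
    "cmod (Complex s R - Complex s (- R)) = 2 * R"
    using s R by (auto simp: cmod_def real_sqrt_mult)
  have "?B * R + ?B * (2 * R) + ?B * R = 8 * 3 ^ k * K / R"
    using R by (simp add: power2_eq_square field_simps)
  moreover have "cmod (?J (Complex 0 (- R)) (Complex s (- R)) + ?J (Complex s (- R)) (Complex s R)
      + ?J (Complex s R) (Complex 0 R)) \<le> ?B * R + ?B * (2 * R) + ?B * R"
    using norm_add3_le[OF side[of "Complex 0 (- R)" "Complex s (- R)"]
        side[of "Complex s (- R)" "Complex s R"] side[of "Complex s R" "Complex 0 R"]]
    unfolding len by blast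
  ultimately show ?thesis by simp
qed


text \<open>
  \<open>F\<close> stands for a Laplace transform and \<open>E\<close> for its truncation at time \<open>t\<close>.  Cauchy's formula at the
  point 1 is applied to \<open>F\<close> on the rectangle \<open>[-\<delta>, R] \<times> [-R, R]\<close> and to the entire function \<open>E\<close> on the
  square \<open>[-R, R]\<^sup>2\<close>.  The two boundaries share their right half, on which only the difference \<open>F - E\<close>
  matters.  This right half and the left half of the square contribute \<open>O(K / R)\<close> each.  The rest of the
  boundary of the rectangle lies in the strip \<open>-\<delta> \<le> Re z \<le> 0\<close>: on its vertical side the factor
  \<open>e\<^bsup>tz\<^esup>\<close> has modulus \<open>e\<^bsup>-\<delta>t\<^esup>\<close>, and its horizontal sides are short and close to the zeros of the kernel.
\<close>

lemma newman_estimate: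
  assumes R: "2 \<le> R" and k: "1 \<le> k" and \<delta>: "0 < \<delta>" "\<delta> \<le> 1" and t: "0 \<le> t"
    and F: "F holomorphic_on S" and S: "convex S" "open S"
      "cbox (Complex (- \<delta>) (- R)) (Complex R R) \<subseteq> S"
    and E: "E holomorphic_on UNIV"
    and K: "0 \<le> K"
    and FB: "\<And>z. - \<delta> \<le> Re z \<Longrightarrow> Re z \<le> 0 \<Longrightarrow> \<bar>Im z\<bar> \<le> R \<Longrightarrow> cmod (F z) \<le> B"
    and FE: "\<And>z. 0 < Re z \<Longrightarrow> cmod (exp (of_real t * z) * (F z - E z)) \<le> K / Re z"
    and EK: "\<And>z. Re z < 0 \<Longrightarrow> cmod (exp (of_real t * z) * E z) \<le> K / \<bar>Re z\<bar>"
  shows "cmod (exp (of_real t) * (F 1 - E 1))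
    \<le> 3 ^ k * (3 * K / R + B * ((1 / R) ^ k + R * exp (- \<delta> * t)))"
proof -
  let ?w = "newman_kernel R k"
  let ?e = "\<lambda>z. exp (of_real t * z)"
  let ?J = "\<lambda>a b f. contour_integral (linepath a b) f"
  define f where "f z = ?e z * F z * ?w z / (z - 1)" for z
  define h where "h z = ?e z * E z * ?w z / (z - 1)" for z
  \<comment> \<open>The rectangle has the corners a, b, c, d and the square the corners u, b, c, v, both anticlockwise
      from the lower left.  The points p and q are where the horizontal sides cross the imaginary axis.\<close>
  define a b c d p q u v where "a = Complex (- \<delta>) (- R)" and "b = Complex R (- R)"
    and "c = Complex R R" and "d = Complex (- \<delta>) R" and "p = Complex 0 (- R)"
    and "q = Complex 0 R" and "u = Complex (- R) (- R)" and "v = Complex (- R) R"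
  note corners = a_def b_def c_def d_def p_def q_def u_def v_def
  have B: "0 \<le> B"
    using FB[of 0] \<delta> R order_trans[OF norm_ge_zero, of "F 0" B] by simp
  have w: "?w holomorphic_on A" for A
    unfolding newman_kernel_def by (intro holomorphic_intros) (use R in auto)
  have holf: "(\<lambda>z. ?e z * F z * ?w z) holomorphic_on S"
    by (intro holomorphic_intros F w)
  have holh: "(\<lambda>z. ?e z * E z * ?w z) holomorphic_on UNIV"
    by (intro holomorphic_intros E w)
  have cf: "continuous_on A f" if "A \<subseteq> S - {1}" for A
    unfolding f_def using that holomorphic_on_imp_continuous_on[OF holf]
    by (intro continuous_on_divide continuous_on_diff continuous_on_id continuous_on_const)
      (auto intro: continuous_on_subset)
  have ch: "continuous_on A h" if "1 \<notin> A" for A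
    unfolding h_def using that holomorphic_on_imp_continuous_on[OF holh]
    by (intro continuous_on_divide continuous_on_diff continuous_on_id continuous_on_const)
      (auto intro: continuous_on_subset)
  have segS: "closed_segment x y \<subseteq> S - {1}"
    if "(x, y) \<in> {(a, b), (b, c), (c, d), (d, a), (a, p), (p, b), (c, q), (q, d)}" for x y
  proof -
    have "closed_segment x y \<subseteq> cbox a c - {1}"
      using that \<delta> R unfolding corners
      by (auto simp: closed_segment_same_Im closed_segment_same_Re closed_segment_eq_real_ivl
          in_cbox_complex_iff split: if_splits)
    with S(3) show ?thesis unfolding corners by auto
  qed
  have segU: "1 \<notin> closed_segment x y"
    if "(x, y) \<in> {(u, b), (b, c), (c, v), (v, u), (u, p), (p, b), (c, q), (q, v)}" for x y
    using that \<delta> R unfolding corners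
    by (auto simp: closed_segment_same_Im closed_segment_same_Re)
  have "2 * pi * \<i> * (?e 1 * F 1 * ?w 1) = ?J a b f + ?J b c f + ?J c d f + ?J d a f"
  proof (rule has_contour_integral_rectpath_sides)
    have one: "1 \<in> box a c"
      using \<delta> R unfolding corners by (auto simp: in_box_complex_iff)
    show "(f has_contour_integral 2 * pi * \<i> * (?e 1 * F 1 * ?w 1)) (rectpath a c)"
      "continuous_on (path_image (rectpath a c)) f"
      unfolding f_def using Cauchy_formula_rectpath[OF holf S(1,2) _ one] S(3)
      by (auto simp: corners)
  qed (auto simp: corners)
  also have "?J a b f = ?J a p f + ?J p b f"
    by (rule contour_integral_split_linepath[OF cf[OF segS]])
      (use \<delta> R in \<open>auto simp: corners closed_segment_same_Im closed_segment_eq_real_ivl\<close>)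
  also have "?J c d f = ?J c q f + ?J q d f"
    by (rule contour_integral_split_linepath[OF cf[OF segS]])
      (use \<delta> R in \<open>auto simp: corners closed_segment_same_Im closed_segment_eq_real_ivl\<close>)
  finally have CF: "2 * pi * \<i> * (?e 1 * F 1 * ?w 1)
      = (?J p b f + ?J b c f + ?J c q f) + (?J q d f + ?J d a f + ?J a p f)"
    by (simp add: algebra_simps)
  have "2 * pi * \<i> * (?e 1 * E 1 * ?w 1) = ?J u b h + ?J b c h + ?J c v h + ?J v u h"
  proof (rule has_contour_integral_rectpath_sides)
    have one: "1 \<in> box u c"
      using R unfolding corners by (auto simp: in_box_complex_iff)
    show "(h has_contour_integral 2 * pi * \<i> * (?e 1 * E 1 * ?w 1)) (rectpath u c)"
      "continuous_on (path_image (rectpath u c)) h"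
      unfolding h_def using Cauchy_formula_rectpath[OF holh convex_UNIV open_UNIV _ one]
      by auto
  qed (auto simp: corners)
  also have "?J u b h = ?J u p h + ?J p b h"
    by (rule contour_integral_split_linepath[OF ch[OF segU]])
      (use R in \<open>auto simp: corners closed_segment_same_Im closed_segment_eq_real_ivl\<close>)
  also have "?J c v h = ?J c q h + ?J q v h"
    by (rule contour_integral_split_linepath[OF ch[OF segU]])
      (use R in \<open>auto simp: corners closed_segment_same_Im closed_segment_eq_real_ivl\<close>)
  also have "?J q v h = - ?J v q h"
    by (rule contour_integral_reverse_linepath[OF ch[OF segU]]) simp
  also have "?J v u h = - ?J u v h"
    by (rule contour_integral_reverse_linepath[OF ch[OF segU]]) simp
  also have "?J u p h = - ?J p u h"
    by (rule contour_integral_reverse_linepath[OF ch[OF segU]]) simp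
  finally have CE: "2 * pi * \<i> * (?e 1 * E 1 * ?w 1)
      = (?J p b h + ?J b c h + ?J c q h) - (?J p u h + ?J u v h + ?J v q h)"
    by (simp add: algebra_simps)
  have fh: "f z - h z = ?e z * (F z - E z) * ?w z / (z - 1)" for z
    by (simp add: f_def h_def diff_divide_distrib algebra_simps)
  have diff: "?J x y f - ?J x y h = ?J x y (\<lambda>z. ?e z * (F z - E z) * ?w z / (z - 1))"
    if "(x, y) \<in> {(p, b), (b, c), (c, q)}" for x y
  proof -
    have "?J x y f - ?J x y h = ?J x y (\<lambda>z. f z - h z)"
      by (rule contour_integral_diff[symmetric]; rule contour_integrable_continuous_linepath)
        (use that in \<open>auto intro!: cf ch segS segU simp del: insert_subset\<close>)
    then show ?thesis unfolding fh .
  qed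
  have "cmod (?J p b (\<lambda>z. ?e z * (F z - E z) * ?w z / (z - 1))
      + ?J b c (\<lambda>z. ?e z * (F z - E z) * ?w z / (z - 1))
      + ?J c q (\<lambda>z. ?e z * (F z - E z) * ?w z / (z - 1))) \<le> 8 * 3 ^ k * K / R"
    unfolding p_def b_def c_def q_def
  proof (rule contour_integral_bound_half_square[OF R k K])
    have "continuous_on A (\<lambda>z. ?e z * (F z - E z) * ?w z / (z - 1))" if "A \<subseteq> S - {1}" for A
      unfolding fh[symmetric] using that by (intro continuous_on_diff cf ch) auto
    then show "continuous_on (closed_segment (Complex 0 (- R)) (Complex R (- R)) \<union>
        closed_segment (Complex R (- R)) (Complex R R) \<union>
        closed_segment (Complex R R) (Complex 0 R)) (\<lambda>z. ?e z * (F z - E z) * ?w z / (z - 1))"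
      using segS[of p b] segS[of b c] segS[of c q] by (simp add: corners)
  qed (use FE R in \<open>auto simp: zero_less_mult_iff\<close>)
  then have right: "cmod ((?J p b f + ?J b c f + ?J c q f) - (?J p b h + ?J b c h + ?J c q h))
      \<le> 8 * 3 ^ k * K / R"
    by (simp add: diff[symmetric] add_diff_add)
  have left: "cmod (?J p u h + ?J u v h + ?J v q h) \<le> 8 * 3 ^ k * K / R"
    unfolding p_def u_def v_def q_def h_def
  proof (rule contour_integral_bound_half_square[OF R k K])
    show "continuous_on (closed_segment (Complex 0 (- R)) (Complex (- R) (- R)) \<union>
        closed_segment (Complex (- R) (- R)) (Complex (- R) R) \<union>
        closed_segment (Complex (- R) R) (Complex 0 R)) (\<lambda>z. ?e z * E z * ?w z / (z - 1))"
      using ch segU[of u p] segU[of v u] segU[of q v] unfolding h_def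
      by (simp add: corners closed_segment_commute)
  qed (use EK R in \<open>auto simp: zero_less_mult_iff mult_less_0_iff\<close>)
  have far: "1 \<le> cmod (z - 1)" if "Re z \<le> 0" for z
    using abs_Re_le_cmod[of "z - 1"] that by simp
  have side: "cmod (?J x y f) \<le> N * cmod (y - x)"
    if "(x, y) \<in> {(q, d), (d, a), (a, p)}" and "0 \<le> N"
      and "\<And>z. z \<in> closed_segment x y \<Longrightarrow> cmod (f z) \<le> N" for x y N
    using that segS[of x y]
    by (intro contour_integral_bound_linepath contour_integrable_continuous_linepath cf) auto
  have hor: "cmod (f z) \<le> B * (3 / R) ^ k"
    if z: "- \<delta> \<le> Re z" "Re z \<le> 0" "\<bar>Im z\<bar> = R" for z
  proof -
    have "cmod (?w z) \<le> (3 * \<bar>Re z\<bar> / R) ^ k"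
      using z \<delta> R by (intro newman_kernel_bound_horizontal) auto
    also have "\<dots> \<le> (3 / R) ^ k"
      using z \<delta> R by (intro power_mono divide_right_mono) auto
    finally have "cmod (f z) \<le> (1 * B * (3 / R) ^ k) / 1"
      unfolding f_def norm_divide norm_mult
      using FB[OF z(1,2)] far[OF z(2)] z t B R
      by (intro frac_le mult_mono) (auto simp: mult_nonneg_nonpos)
    then show ?thesis by simp
  qed
  have ver: "cmod (f z) \<le> exp (- \<delta> * t) * B * 3 ^ k" if z: "Re z = - \<delta>" "\<bar>Im z\<bar> \<le> R" for z
  proof -
    have "cmod (f z) \<le> (exp (- \<delta> * t) * B * 3 ^ k) / 1"
      unfolding f_def norm_divide norm_mult
      using FB[of z] far[of z] newman_kernel_bound[of R z k] z B R \<delta>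
      by (intro frac_le mult_mono) (auto simp: mult.commute)
    then show ?thesis by simp
  qed
  have len: "cmod (d - q) = \<delta>" "cmod (a - d) = 2 * R" "cmod (p - a) = \<delta>"
    using R \<delta> by (auto simp: corners cmod_def real_sqrt_mult)
  have "cmod (f z) \<le> B * (3 / R) ^ k" if "z \<in> closed_segment q d \<or> z \<in> closed_segment a p" for z
    by (rule hor) (use that R \<delta> in \<open>auto simp: corners closed_segment_same_Im closed_segment_eq_real_ivl\<close>)
  moreover have "cmod (f z) \<le> exp (- \<delta> * t) * B * 3 ^ k" if "z \<in> closed_segment d a" for z
    by (rule ver) (use that R \<delta> in \<open>auto simp: corners closed_segment_same_Re closed_segment_eq_real_ivl\<close>)
  ultimately have "cmod (?J q d f) \<le> B * (3 / R) ^ k * \<delta>" "cmod (?J a p f) \<le> B * (3 / R) ^ k * \<delta>"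
    "cmod (?J d a f) \<le> exp (- \<delta> * t) * B * 3 ^ k * (2 * R)"
    using side[of q d "B * (3 / R) ^ k"] side[of a p "B * (3 / R) ^ k"]
      side[of d a "exp (- \<delta> * t) * B * 3 ^ k"] B R by (simp_all add: len)
  moreover have "B * (3 / R) ^ k * \<delta> \<le> B * (3 / R) ^ k"
    using B R \<delta> by (intro mult_left_le) auto
  ultimately have shallow: "cmod (?J q d f + ?J d a f + ?J a p f)
      \<le> 2 * B * (3 / R) ^ k + 2 * R * exp (- \<delta> * t) * B * 3 ^ k"
    using norm_triangle_ineq[of "?J q d f + ?J d a f" "?J a p f"]
      norm_triangle_ineq[of "?J q d f" "?J d a f"] by (simp add: algebra_simps)
  have "2 * pi * \<i> * ?w 1 * (?e 1 * (F 1 - E 1))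
      = ((?J p b f + ?J b c f + ?J c q f) - (?J p b h + ?J b c h + ?J c q h))
        + (?J q d f + ?J d a f + ?J a p f) + (?J p u h + ?J u v h + ?J v q h)"
    using CF CE by (simp add: algebra_simps)
  also have "cmod \<dots> \<le> 8 * 3 ^ k * K / R
      + (2 * B * (3 / R) ^ k + 2 * R * exp (- \<delta> * t) * B * 3 ^ k) + 8 * 3 ^ k * K / R"
    by (rule norm_add3_le[OF right shallow left])
  finally have "cmod (2 * pi * \<i> * ?w 1 * (?e 1 * (F 1 - E 1)))
      \<le> 16 * 3 ^ k * K / R + (2 * B * (3 / R) ^ k + 2 * R * exp (- \<delta> * t) * B * 3 ^ k)"
    by (simp add: mult.commute mult.left_commute)
  \<comment> \<open>The kernel is real and at least 1 at the pole, so dividing by it preserves the upper bound.\<close>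
  moreover have "1 \<le> cmod (?w 1)"
  proof -
    have "?w 1 = of_real ((1 + 1 / R\<^sup>2) ^ k)"
      by (simp add: newman_kernel_def)
    then have "cmod (?w 1) = (1 + 1 / R\<^sup>2) ^ k"
      by (simp only: norm_of_real) simp
    then show ?thesis by simp
  qed
  \<comment> \<open>Rounding \<open>2 * pi\<close> down to 6 gives integer constants.\<close>
  moreover have "6 * 1 * cmod (?e 1 * (F 1 - E 1)) \<le> cmod (2 * pi * \<i> * ?w 1 * (?e 1 * (F 1 - E 1)))"
    unfolding norm_mult using calculation(2) pi_gt3 by (intro mult_mono) auto
  ultimately have "6 * cmod (?e 1 * (F 1 - E 1))
      \<le> 16 * 3 ^ k * K / R + (2 * B * (3 / R) ^ k + 2 * R * exp (- \<delta> * t) * B * 3 ^ k)"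
    by simp
  moreover have "3 ^ k * (3 * K / R + B * ((1 / R) ^ k + R * exp (- \<delta> * t)))
     = 3 * (3 ^ k * K / R) + B * (3 / R) ^ k + R * exp (- \<delta> * t) * B * 3 ^ k"
    by (simp add: power_divide algebra_simps)
  moreover have "0 \<le> 3 ^ k * K / R" "0 \<le> B * (3 / R) ^ k" "0 \<le> R * exp (- \<delta> * t) * B * 3 ^ k"
    using K B R by auto
  ultimately show ?thesis by simp
qed

section \<open>Decay of scalar functions\<close>

lemma truncated_laplace_holomorphic:
  assumes g: "continuous_on {0..t} g"
  shows "(\<lambda>z. integral {0..t} (\<lambda>s. exp (- (of_real s * z)) * g s)) holomorphic_on A"
proof -
  have "(\<lambda>z. integral (cbox 0 t) (\<lambda>s. exp (- (of_real s * z)) * g s)) holomorphic_on UNIV"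
  proof (rule leibniz_rule_holomorphic)
    show "((\<lambda>z. exp (- (of_real s * z)) * g s) has_field_derivative
        - of_real s * exp (- (of_real s * z)) * g s) (at z within UNIV)" for z s
      by (auto intro!: derivative_eq_intros)
    show "(\<lambda>s. exp (- (of_real s * z)) * g s) integrable_on cbox 0 t" for z
      using g by (intro integrable_continuous continuous_intros) simp
    have "continuous_on (UNIV \<times> {0..t}) (\<lambda>p. g (snd p))"
      by (rule continuous_on_compose2[OF g continuous_on_snd[OF continuous_on_id]]) auto
    then show "continuous_on (UNIV \<times> cbox 0 t) (\<lambda>(z, s). - of_real s * exp (- (of_real s * z)) * g s)"
      unfolding split_beta by (intro continuous_intros) auto
  qed simp
  then show ?thesis
    by (auto intro: holomorphic_on_subset)
qed

text \<open>
  The factor \<open>e\<^bsup>tz\<^esup>\<close> turns the integrand into \<open>e\<^bsup>(t - s)z\<^esup> g(s)\<close>, which decays away from \<open>s = t\<close>.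
\<close>

lemma truncated_laplace_left_bound:
  assumes t: "0 \<le> t" and g: "continuous_on {0..t} g" and K: "\<And>s. s \<in> {0..t} \<Longrightarrow> cmod (g s) \<le> K"
    and z: "Re z < 0"
  shows "cmod (exp (of_real t * z) * integral {0..t} (\<lambda>s. exp (- (of_real s * z)) * g s)) \<le> K / \<bar>Re z\<bar>"
proof -
  have int: "((\<lambda>s. exp (- (s * Re z)) * K) has_integral
      (- (exp (- (t * Re z)) * K / Re z) - (- (exp (- (0 * Re z)) * K / Re z)))) {0..t}"
    using z t
    by (intro fundamental_theorem_of_calculus)
      (auto intro!: derivative_eq_intros
        simp: has_real_derivative_iff_has_vector_derivative[symmetric] field_simps)
  have K0: "0 \<le> K"
    using K[of 0] t order_trans[OF norm_ge_zero] by auto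
  have "cmod (integral {0..t} (\<lambda>s. exp (- (of_real s * z)) * g s))
      \<le> integral {0..t} (\<lambda>s. exp (- (s * Re z)) * K)"
  proof (rule integral_norm_bound_integral)
    show "(\<lambda>s. exp (- (s * Re z)) * K) integrable_on {0..t}"
      using int by blast
    show "(\<lambda>s. exp (- (of_real s * z)) * g s) integrable_on {0..t}"
      using g by (intro integrable_continuous_real continuous_intros)
  qed (auto simp: norm_mult intro: K mult_left_mono)
  also have "\<dots> = K / Re z - exp (- (t * Re z)) * K / Re z"
    using integral_unique[OF int] by simp
  finally have "cmod (exp (of_real t * z) * integral {0..t} (\<lambda>s. exp (- (of_real s * z)) * g s))
      \<le> exp (t * Re z) * (K / Re z - exp (- (t * Re z)) * K / Re z)"
    by (simp add: norm_mult)
  also have "\<dots> = K / \<bar>Re z\<bar> - exp (t * Re z) * K / \<bar>Re z\<bar>"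
    using z by (simp add: right_diff_distrib exp_minus)
  also have "\<dots> \<le> K / \<bar>Re z\<bar>"
    using K0 by simp
  finally show ?thesis .
qed

text \<open>
  In the contour estimate the transform is at most \<open>M1 (1 + R)\<^sup>\<beta>\<close> on the shallow contour.  The choice
  \<open>k \<ge> \<beta> + 1\<close> beats this growth on the horizontal sides, and the hypothesis \<open>tR\<close>, which says that
  \<open>e\<^bsup>-\<delta>t\<^esup>\<close> is at most \<open>R\<close> to the power \<open>-(\<beta> + 2)\<close> for the available depth \<open>\<delta>\<close>, beats it on the
  vertical side of length \<open>2 R\<close>.  Everything is then \<open>O(1 / R)\<close>.
\<close>

lemma scalar_decay_at_scale:
  assumes \<alpha>: "0 < \<alpha>" and \<beta>: "0 < \<beta>" and c: "0 < c" "c \<le> 1"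
    and k: "\<beta> + 1 \<le> real k" and R: "2 \<le> R" and t: "0 \<le> t"
    and tR: "(\<beta> + 2) * ln R \<le> c / 2 * (2 * R) powr (- \<alpha>) * t"
    and g: "continuous_on {0..t} g" and K: "\<And>s. s \<in> {0..t} \<Longrightarrow> cmod (g s) \<le> K"
    and F: "F holomorphic_on Omega \<alpha> c"
    and FB: "\<And>z. z \<in> Omega \<alpha> c \<Longrightarrow> cmod (F z) \<le> M1 * (1 + \<bar>Im z\<bar>) powr \<beta>"
    and E: "\<And>z. E z = integral {0..t} (\<lambda>s. exp (- (of_real s * z)) * g s)"
    and FE: "\<And>z. 0 < Re z \<Longrightarrow> cmod (exp (of_real t * z) * (F z - E z)) \<le> K / Re z"
  shows "cmod (exp (of_real t) * (F 1 - E 1)) \<le> 3 ^ k * (3 * K + 2 powr (\<beta> + 1) * M1) / R"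
proof -
  \<comment> \<open>The largest depth for which the strip of height slightly above R stays in the region; unlike the
      region, the set S is convex.  The contour uses half of this depth to stay inside S.\<close>
  define d where "d = c * (2 + R) powr (- \<alpha>)"
  define S where "S = {z. Re z > - d} \<inter> ({z. Im z < R + 1} \<inter> {z. Im z > - (R + 1)})"
  have d: "0 < d" "d \<le> 1"
  proof -
    show "0 < d" using c R by (simp add: d_def)
    have "(2 + R) powr (- \<alpha>) \<le> (2 + R) powr 0"
      using R \<alpha> by (intro powr_mono) auto
    with c R show "d \<le> 1"
      by (auto simp: d_def intro: mult_le_one)
  qed
  have S_sub: "S \<subseteq> Omega \<alpha> c"
  proof
    fix z assume z: "z \<in> S"
    then have "(2 + R) powr (- \<alpha>) \<le> (1 + \<bar>Im z\<bar>) powr (- \<alpha>)"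
      using R \<alpha> by (intro powr_mono2') (auto simp: S_def)
    then have "d \<le> c * (1 + \<bar>Im z\<bar>) powr (- \<alpha>)"
      using c by (auto simp: d_def)
    with z show "z \<in> Omega \<alpha> c"
      by (simp add: S_def Omega_def)
  qed
  have M1: "0 \<le> M1"
  proof -
    have "(1 :: complex) \<in> S" using d R by (simp add: S_def)
    then have "cmod (F 1) \<le> M1"
      using FB[of 1] S_sub by auto
    then show ?thesis by (rule order_trans[OF norm_ge_zero])
  qed
  have K0: "0 \<le> K"
    using K[of 0] t order_trans[OF norm_ge_zero] by auto
  let ?B = "M1 * (1 + R) powr \<beta>"
  have "cmod (exp (of_real t) * (F 1 - E 1))
      \<le> 3 ^ k * (3 * K / R + ?B * ((1 / R) ^ k + R * exp (- (d / 2) * t)))"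
  proof (rule newman_estimate[where S = S])
    show "convex S" unfolding S_def
      by (intro convex_Int convex_halfspace_Re_gt convex_halfspace_Im_lt convex_halfspace_Im_gt)
    show "open S" unfolding S_def
      by (intro open_Int open_halfspace_Re_gt open_halfspace_Im_lt open_halfspace_Im_gt)
    show "cbox (Complex (- (d / 2)) (- R)) (Complex R R) \<subseteq> S"
      using d by (auto simp: S_def in_cbox_complex_iff)
    show "F holomorphic_on S"
      using F S_sub by (rule holomorphic_on_subset)
    show "E holomorphic_on UNIV"
      using truncated_laplace_holomorphic[OF g] by (simp add: E[abs_def])
    show "cmod (exp (of_real t * z) * E z) \<le> K / \<bar>Re z\<bar>" if "Re z < 0" for z
      unfolding E by (rule truncated_laplace_left_bound[OF t g K that])
    show "cmod (F z) \<le> ?B" if "- (d / 2) \<le> Re z" "Re z \<le> 0" "\<bar>Im z\<bar> \<le> R" for z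
    proof -
      have "z \<in> Omega \<alpha> c" using that d S_sub by (auto simp: S_def)
      then have "cmod (F z) \<le> M1 * (1 + \<bar>Im z\<bar>) powr \<beta>" by (rule FB)
      also have "\<dots> \<le> ?B"
        using that(3) \<beta> M1 by (intro mult_left_mono powr_mono2) auto
      finally show ?thesis .
    qed
  qed (use R k \<beta> d t K0 FE in auto)
  also have "\<dots> \<le> 3 ^ k * (3 * K / R + 2 powr (\<beta> + 1) * M1 / R)"
  proof -
    have B: "?B \<le> M1 * 2 powr \<beta> * R powr \<beta>"
      using R \<beta> M1 powr_mono2[of \<beta> "1 + R" "2 * R"]
      by (simp add: powr_mult mult_left_mono mult.assoc)
    have "exp (- (d / 2) * t) \<le> R powr (- (\<beta> + 2))"
    proof -
      have "(2 * R) powr (- \<alpha>) \<le> (2 + R) powr (- \<alpha>)"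
        using R \<alpha> by (intro powr_mono2') auto
      then have "c / 2 * (2 * R) powr (- \<alpha>) * t \<le> d / 2 * t"
        using c t by (auto simp: d_def intro!: mult_right_mono)
      with tR have "(\<beta> + 2) * ln R \<le> d / 2 * t" by linarith
      then show ?thesis
        using R by (simp add: powr_def algebra_simps)
    qed
    then have "R * exp (- (d / 2) * t) \<le> R powr 1 * R powr (- (\<beta> + 2))"
      using R by (intro mult_mono) auto
    also have "\<dots> = R powr (- (\<beta> + 1))"
      unfolding powr_add[symmetric] by (simp add: algebra_simps)
    finally have e: "R * exp (- (d / 2) * t) \<le> R powr (- (\<beta> + 1))" .
    have "(1 / R) ^ k = R powr (- real k)"
      using R by (simp add: powr_minus powr_realpow power_divide field_simps)
    also have "\<dots> \<le> R powr (- (\<beta> + 1))"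
      using R k by (intro powr_mono) auto
    finally have "(1 / R) ^ k + R * exp (- (d / 2) * t) \<le> 2 * R powr (- (\<beta> + 1))"
      using e by linarith
    then have "?B * ((1 / R) ^ k + R * exp (- (d / 2) * t))
        \<le> M1 * 2 powr \<beta> * R powr \<beta> * (2 * R powr (- (\<beta> + 1)))"
      using M1 R by (intro mult_mono[OF B]) auto
    also have "\<dots> = 2 powr (\<beta> + 1) * M1 * (R powr \<beta> * R powr (- (\<beta> + 1)))"
      by (simp add: powr_add)
    also have "R powr \<beta> * R powr (- (\<beta> + 1)) = 1 / R"
      using R by (simp add: powr_add[symmetric] powr_minus_divide)
    finally show ?thesis
      by (intro mult_left_mono add_left_mono) auto
  qed
  also have "\<dots> = 3 ^ k * (3 * K + 2 powr (\<beta> + 1) * M1) / R"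
    using R by (simp add: field_simps)
  finally show ?thesis .
qed

text \<open>
  The largest scale, up to a constant factor, at which \<open>scalar_decay_at_scale\<close> applies: \<open>R\<^sup>\<alpha>\<close> is
  proportional to \<open>t / ln t\<close>, so that the depth \<open>R\<^bsup>-\<alpha>\<^esup>\<close> times \<open>t\<close> is a sufficiently large multiple of \<open>ln t\<close> and
  hence of \<open>ln R\<close>.  The bound \<open>a \<le> ln 2\<close> gives \<open>R\<^sup>\<alpha> \<le> t\<close>.
\<close>

lemma balanced_scale:
  fixes \<alpha> \<beta> c a t :: real
  assumes \<alpha>: "0 < \<alpha>" and \<beta>: "0 < \<beta>" and c: "0 < c"
    and a: "0 < a" "a \<le> ln 2" "a \<le> c * 2 powr (- \<alpha>) * \<alpha> / (2 * (\<beta> + 2))"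
    and t: "2 \<le> t" and R: "R = (a * t / ln t) powr (1 / \<alpha>)"
  shows "(\<beta> + 2) * ln R \<le> c / 2 * (2 * R) powr (- \<alpha>) * t"
    and "1 / R = a powr (- 1 / \<alpha>) * (ln t / t) powr (1 / \<alpha>)"
proof -
  have lt: "ln 2 \<le> ln t" "0 < ln t" "0 < t"
    using t by auto
  have q: "0 < a * t / ln t" using a lt by simp
  have "a * t / ln t \<le> t"
    using a lt order_trans[OF a(2) lt(1)] by (simp add: field_simps)
  then have "ln R \<le> ln t / \<alpha>"
    using q \<alpha> lt R by (simp add: ln_powr divide_right_mono)
  then have "(\<beta> + 2) * ln R \<le> (\<beta> + 2) * (ln t / \<alpha>)"
    using \<beta> by (intro mult_left_mono) auto
  also have "(\<beta> + 2) * (ln t / \<alpha>) \<le> c / 2 * 2 powr (- \<alpha>) * (ln t / a)"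
  proof -
    have "a * (2 * (\<beta> + 2)) \<le> c * 2 powr (- \<alpha>) * \<alpha>"
      using a \<beta> by (simp add: pos_le_divide_eq)
    then have "a * (2 * (\<beta> + 2)) * ln t \<le> c * 2 powr (- \<alpha>) * \<alpha> * ln t"
      using lt by (intro mult_right_mono) auto
    then show ?thesis
      using a \<alpha> by (simp add: field_simps)
  qed
  also have "\<dots> = c / 2 * (2 * R) powr (- \<alpha>) * t"
  proof -
    have "R powr (- \<alpha>) = ln t / (a * t)"
      using \<alpha> a lt by (simp add: R powr_powr powr_minus)
    then show ?thesis
      using R q lt by (simp add: powr_mult)
  qed
  finally show "(\<beta> + 2) * ln R \<le> c / 2 * (2 * R) powr (- \<alpha>) * t" .
  have "R = a powr (1 / \<alpha>) / (ln t / t) powr (1 / \<alpha>)"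
    using a lt by (simp add: R powr_mult powr_divide)
  then show "1 / R = a powr (- 1 / \<alpha>) * (ln t / t) powr (1 / \<alpha>)"
    by (simp add: powr_minus_divide)
qed

lemma Omega_mono: "c \<le> c' \<Longrightarrow> Omega \<alpha> c \<subseteq> Omega \<alpha> c'"
  unfolding Omega_def by (auto intro: le_less_trans[OF le_imp_neg_le[OF mult_right_mono]])

text \<open>
  If the scale \<open>R\<close> is at least 2, the contour estimate gives \<open>O(1 / R)\<close>.  If \<open>R < 2\<close>, the transform bound
  at \<open>z = 1\<close> alone gives \<open>K\<close>, which is again \<open>O(1 / R)\<close>.
\<close>

lemma scalar_decay:
  fixes \<alpha> \<beta> c1 :: real
  assumes \<alpha>: "0 < \<alpha>" and \<beta>: "0 < \<beta>" and c1: "0 < c1"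
  shows "\<exists>C>0. \<forall>t K M1 g F. 2 \<le> t \<longrightarrow> 0 \<le> M1 \<longrightarrow>
    continuous_on {0..t} g \<longrightarrow> (\<forall>s\<in>{0..t}. cmod (g s) \<le> K) \<longrightarrow>
    F holomorphic_on Omega \<alpha> c1 \<longrightarrow>
    (\<forall>z\<in>Omega \<alpha> c1. cmod (F z) \<le> M1 * (1 + \<bar>Im z\<bar>) powr \<beta>) \<longrightarrow>
    (\<forall>z. 0 < Re z \<longrightarrow> cmod (exp (of_real t * z) *
        (F z - integral {0..t} (\<lambda>s. exp (- (of_real s * z)) * g s))) \<le> K / Re z) \<longrightarrow>
    cmod (exp (of_real t) * (F 1 - integral {0..t} (\<lambda>s. exp (- of_real s) * g s)))
      \<le> C * (K + M1) * (ln t / t) powr (1 / \<alpha>)"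
proof -
  \<comment> \<open>Shrinking the region keeps the depth of the contour at most 1.\<close>
  define c where "c = min c1 1"
  define a where "a = min (ln 2) (c * 2 powr (- \<alpha>) * \<alpha> / (2 * (\<beta> + 2)))"
  define k where "k = nat \<lceil>\<beta> + 1\<rceil>"
  define N where "N = 3 ^ k * (3 + 2 powr (\<beta> + 1))"
  have c: "0 < c" "c \<le> 1" "c \<le> c1" using c1 by (auto simp: c_def)
  have a: "0 < a" "a \<le> ln 2" "a \<le> c * 2 powr (- \<alpha>) * \<alpha> / (2 * (\<beta> + 2))"
    using c \<alpha> \<beta> by (auto simp: a_def)
  have k: "\<beta> + 1 \<le> real k" unfolding k_def by linarith
  have N: "3 ^ k * 3 \<le> N" "3 ^ k * 2 powr (\<beta> + 1) \<le> N" "2 \<le> N"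
  proof -
    show "3 ^ k * 3 \<le> N" "3 ^ k * 2 powr (\<beta> + 1) \<le> N"
      by (auto simp: N_def distrib_left)
    have "(1::real) \<le> 3 ^ k" by simp
    with \<open>3 ^ k * 3 \<le> N\<close> show "2 \<le> N" by linarith
  qed
  have main: "cmod (exp (of_real t) * (F 1 - integral {0..t} (\<lambda>s. exp (- of_real s) * g s)))
      \<le> (N * a powr (- 1 / \<alpha>)) * (K + M1) * (ln t / t) powr (1 / \<alpha>)"
    if t: "2 \<le> t" and M1: "0 \<le> M1" and g: "continuous_on {0..t} g" and K: "\<forall>s\<in>{0..t}. cmod (g s) \<le> K"
      and F: "F holomorphic_on Omega \<alpha> c1"
      and FB: "\<forall>z\<in>Omega \<alpha> c1. cmod (F z) \<le> M1 * (1 + \<bar>Im z\<bar>) powr \<beta>"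
      and FE: "\<forall>z. 0 < Re z \<longrightarrow> cmod (exp (of_real t * z) *
        (F z - integral {0..t} (\<lambda>s. exp (- (of_real s * z)) * g s))) \<le> K / Re z" for t K M1 g F
  proof -
    define R where "R = (a * t / ln t) powr (1 / \<alpha>)"
    note scale = balanced_scale[OF \<alpha> \<beta> c(1) a t R_def]
    have Rpos: "0 < R"
      using a t by (simp add: R_def)
    have K0: "0 \<le> K"
      using K t order_trans[OF norm_ge_zero, of "g 0" K] by auto
    let ?h = "cmod (exp (of_real t) * (F 1 - integral {0..t} (\<lambda>s. exp (- of_real s) * g s)))"
    have "?h \<le> N * (K + M1) / R"
    proof (cases "2 \<le> R")
      case True
      have "?h \<le> 3 ^ k * (3 * K + 2 powr (\<beta> + 1) * M1) / R"
        using scalar_decay_at_scale[OF \<alpha> \<beta> c(1,2) k True _ scale(1) g _ _ _ refl, of K F M1]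
          t K FE FB holomorphic_on_subset[OF F Omega_mono[OF c(3)]] Omega_mono[OF c(3), of \<alpha>]
        by auto
      also have "\<dots> \<le> N * (K + M1) / R"
      proof (rule divide_right_mono)
        have "3 ^ k * 3 * K + 3 ^ k * 2 powr (\<beta> + 1) * M1 \<le> N * K + N * M1"
          by (intro add_mono mult_right_mono N K0 M1)
        then show "3 ^ k * (3 * K + 2 powr (\<beta> + 1) * M1) \<le> N * (K + M1)"
          by (simp add: distrib_left mult.assoc)
      qed (use Rpos in simp)
      finally show ?thesis .
    next
      case False
      have "?h \<le> K" using FE[rule_format, of 1] by simp
      also have "\<dots> \<le> N * (K + M1) / R"
      proof -
        have "K * R \<le> (K + M1) * 2"
          using False K0 M1 Rpos by (intro mult_mono) auto
        also have "\<dots> \<le> (K + M1) * N"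
          using N K0 M1 by (intro mult_left_mono) auto
        finally show ?thesis
          using Rpos by (simp add: field_simps)
      qed
      finally show ?thesis .
    qed
    also have "\<dots> = N * (K + M1) * (1 / R)" by simp
    also have "\<dots> = (N * a powr (- 1 / \<alpha>)) * (K + M1) * (ln t / t) powr (1 / \<alpha>)"
      unfolding scale(2) by simp
    finally show ?thesis .
  qed
  show ?thesis
    by (rule exI[of _ "N * a powr (- 1 / \<alpha>)"]) (use main N a in auto)
qed


section \<open>Decay of the semigroup\<close>

lemma functional_holomorphic:
  fixes F :: "complex \<Rightarrow> 'a :: complex_normed_vector"
  assumes F: "F vector_holomorphic_on S"
    and \<phi>: "bounded_linear \<phi>" "\<And>c x. \<phi> (c *\<^sub>C x) = c * \<phi> x"
  shows "(\<lambda>z. \<phi> (F z)) holomorphic_on S"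
  unfolding holomorphic_on_def field_differentiable_def has_field_derivative_iff
proof
  fix z assume "z \<in> S"
  then obtain d where "((\<lambda>w. inverse (w - z) *\<^sub>C (F w - F z)) \<longlongrightarrow> d) (at z within S)"
    using F unfolding vector_holomorphic_on_def by blast
  from bounded_linear.tendsto[OF \<phi>(1) this]
  have "((\<lambda>w. (\<phi> (F w) - \<phi> (F z)) / (w - z)) \<longlongrightarrow> \<phi> d) (at z within S)"
    by (simp add: \<phi>(2) bounded_linear.linear[OF \<phi>(1)] linear_diff divide_inverse mult.commute)
  then show "\<exists>D. ((\<lambda>w. (\<phi> (F w) - \<phi> (F z)) / (w - z)) \<longlongrightarrow> D) (at z within S)"
    by blast
qed

theorem corollary3p7:
  fixes \<alpha> \<beta> c1 M M1 :: real
  assumes "\<alpha> > 0" and "\<beta> > 0" and "c1 > 0"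
  shows "\<exists>c :: real \<Rightarrow> real \<Rightarrow> real. (\<forall>a b. c a b > 0) \<and>
    (\<forall>(T :: real \<Rightarrow> 'a :: complex_banach \<Rightarrow>\<^sub>L 'a) (T1 :: 'a \<Rightarrow>\<^sub>L 'a) (T2 :: 'a \<Rightarrow>\<^sub>L 'a)
        (F :: complex \<Rightarrow> 'a \<Rightarrow>\<^sub>L 'a).
      C0_semigroup T \<and>
      bdd_above ((\<lambda>t. norm (T t)) ` {0..}) \<and> (SUP t\<in>{0..}. norm (T t)) = M \<and>
      T1 \<in> complex_blinfuns \<and> T2 \<in> complex_blinfuns \<and>
      (\<forall>z. Re z > 0 \<longrightarrow> F z = T1 o\<^sub>L resolvent z (generator T) o\<^sub>L T2) \<and>
      (\<forall>z\<in>Omega \<alpha> c1. F z \<in> complex_blinfuns) \<and>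
      F vector_holomorphic_on Omega \<alpha> c1 \<and>
      (\<forall>z\<in>Omega \<alpha> c1. norm (F z) \<le> M1 * (1 + \<bar>Im z\<bar>) powr \<beta>) \<longrightarrow>
      (\<forall>t\<ge>2. norm (T1 o\<^sub>L T t o\<^sub>L resolvent 1 (generator T) o\<^sub>L T2)
               \<le> c (norm T1) (norm T2) * (ln t / t) powr (1 / \<alpha>)))"
proof -
  obtain C where C: "0 < C" and decay: "\<And>t K M1 g F. \<lbrakk>2 \<le> t; 0 \<le> M1; continuous_on {0..t} g;
    \<forall>s\<in>{0..t}. cmod (g s) \<le> K; F holomorphic_on Omega \<alpha> c1;
    \<forall>z\<in>Omega \<alpha> c1. cmod (F z) \<le> M1 * (1 + \<bar>Im z\<bar>) powr \<beta>;
    \<forall>z. 0 < Re z \<longrightarrow> cmod (exp (of_real t * z) *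
        (F z - integral {0..t} (\<lambda>s. exp (- (of_real s * z)) * g s))) \<le> K / Re z\<rbrakk>
    \<Longrightarrow> cmod (exp (of_real t) * (F 1 - integral {0..t} (\<lambda>s. exp (- of_real s) * g s)))
      \<le> C * (K + M1) * (ln t / t) powr (1 / \<alpha>)"
    using scalar_decay[OF assms] by blast
  \<comment> \<open>The final summand 1 only makes the constant positive when all other terms vanish.\<close>
  define c where "c a b = C * (2 * (\<bar>M\<bar> + M\<^sup>2) * \<bar>a\<bar> * \<bar>b\<bar> + 2 * \<bar>M1\<bar> + 1)" for a b :: real
  have c_pos: "0 < c a b" for a b
    unfolding c_def using C by (intro mult_pos_pos) (auto intro!: add_nonneg_pos add_nonneg_nonneg)
  have main: "norm (T1 o\<^sub>L T t o\<^sub>L resolvent 1 (generator T) o\<^sub>L T2)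
      \<le> c (norm T1) (norm T2) * (ln t / t) powr (1 / \<alpha>)"
    if T: "C0_semigroup T" and bdd: "bdd_above ((\<lambda>t. norm (T t)) ` {0..})"
      and SUP: "(SUP t\<in>{0..}. norm (T t)) = M" and T1: "T1 \<in> complex_blinfuns"
      and FR: "\<forall>z. Re z > 0 \<longrightarrow> F z = T1 o\<^sub>L resolvent z (generator T) o\<^sub>L T2"
      and hol: "F vector_holomorphic_on Omega \<alpha> c1"
      and FM: "\<forall>z\<in>Omega \<alpha> c1. norm (F z) \<le> M1 * (1 + \<bar>Im z\<bar>) powr \<beta>"
      and t: "2 \<le> t"
    for T :: "real \<Rightarrow> 'a \<Rightarrow>\<^sub>L 'a" and T1 T2 :: "'a \<Rightarrow>\<^sub>L 'a" and F :: "complex \<Rightarrow> 'a \<Rightarrow>\<^sub>L 'a" and t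
  proof (rule norm_blinfun_bound)
    have M: "norm (T s) \<le> M" if "0 \<le> s" for s
      unfolding SUP[symmetric] by (rule cSUP_upper[OF _ bdd]) (use that in simp)
    have M0: "0 \<le> M" by (rule semigroup_bound_nonneg[OF T M])
    have M1: "0 \<le> M1"
    proof -
      have "(1 :: complex) \<in> Omega \<alpha> c1"
        using assms by (simp add: Omega_def)
      with FM have "norm (F 1) \<le> M1" by force
      then show ?thesis by (rule order_trans[OF norm_ge_zero])
    qed
    let ?rate = "(ln t / t) powr (1 / \<alpha>)"
    show "0 \<le> c (norm T1) (norm T2) * ?rate"
      using c_pos[of "norm T1" "norm T2"] by simp
    fix x :: 'a
    let ?v = "(T1 o\<^sub>L T t o\<^sub>L resolvent 1 (generator T) o\<^sub>L T2) x"
    obtain \<phi> :: "'a \<Rightarrow> complex" where \<phi>: "bounded_linear \<phi>" "\<And>c y. \<phi> (c *\<^sub>C y) = c * \<phi> y"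
      "\<And>y. cmod (\<phi> y) \<le> 2 * norm y" "norm ?v \<le> cmod (\<phi> ?v)"
      using exists_norming_functional[of ?v] by blast
    define \<psi> where "\<psi> y = \<phi> (T1 y)" for y
    have \<psi>: "bounded_linear \<psi>" "\<And>c y. \<psi> (c *\<^sub>C y) = c * \<psi> y"
      using bounded_linear_compose[OF \<phi>(1) blinfun.bounded_linear_right, of T1] \<phi>(2) T1
      by (auto simp: \<psi>_def[abs_def] complex_blinfuns_def)
    have \<psi>_le: "cmod (\<psi> y) \<le> 2 * norm T1 * norm y" for y
      using \<phi>(3)[of "T1 y"] norm_blinfun[of T1 y] by (simp add: \<psi>_def)
    \<comment> \<open>The orbit is bounded by a multiple of M; the tail of its transform contains both the semigroup and
        the resolvent and is bounded by the same multiple of \<open>M\<^sup>2 / Re z\<close>.\<close>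
    define K where "K = 2 * (M + M\<^sup>2) * norm T1 * norm T2 * norm x"
    define g where "g s = \<psi> (T s (T2 x))" for s
    define f where "f z = \<phi> (F z x)" for z
    have laplace: "integral {0..t} (\<lambda>s. exp (- (of_real s * z)) * g s) = \<psi> (laplace_upto T z t (T2 x))" for z
    proof -
      have "\<psi> (laplace_upto T z t (T2 x))
          = integral {0..t} (\<lambda>s. \<psi> (exp (- (of_real s * z)) *\<^sub>C T s (T2 x)))"
        unfolding laplace_upto_def
        by (rule integral_linear[OF scaled_orbit_integrable[OF T M order_refl] \<psi>(1),
              unfolded o_def, symmetric])
      then show ?thesis by (simp add: \<psi>(2) g_def)
    qed
    \<comment> \<open>The left-hand side is the rescaled tail of the transform of g; for \<open>z = 1\<close> the right-hand side is
        \<open>\<phi>\<close> applied to the vector whose norm is to be estimated.\<close>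
    have diff: "exp (of_real t * z) * (f z - integral {0..t} (\<lambda>s. exp (- (of_real s * z)) * g s))
        = \<psi> (T t (resolvent z (generator T) (T2 x)))" if z: "0 < Re z" for z
    proof -
      have "f z = \<psi> (resolvent z (generator T) (T2 x))"
        using FR z by (simp add: f_def \<psi>_def)
      then have "f z - integral {0..t} (\<lambda>s. exp (- (of_real s * z)) * g s)
          = \<psi> (exp (- (of_real t * z)) *\<^sub>C T t (resolvent z (generator T) (T2 x)))"
        using t by (simp add: laplace resolvent_properties(2)[OF T M z] linear_diff bounded_linear.linear[OF \<psi>(1)])
      then show ?thesis
        by (simp add: \<psi>(2) mult.assoc[symmetric] exp_add[symmetric])
    qed
    have "norm ?v \<le> cmod (\<phi> ?v)" by (rule \<phi>(4))
    also have "\<phi> ?v = exp (of_real t) * (f 1 - integral {0..t} (\<lambda>s. exp (- of_real s) * g s))"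
      using diff[of 1] by (simp add: \<psi>_def)
    also have "cmod \<dots> \<le> C * (K + 2 * M1 * norm x) * ?rate"
    proof (rule decay[OF t])
      show "0 \<le> 2 * M1 * norm x" using M1 by simp
      show "continuous_on {0..t} g"
        unfolding g_def
        by (rule bounded_linear.continuous_on[OF \<psi>(1)])
          (rule continuous_on_subset[OF semigroup_continuous_on[OF T M]], auto)
      show "\<forall>s\<in>{0..t}. cmod (g s) \<le> K"
      proof
        fix s assume "s \<in> {0..t}"
        then have "norm (T s (T2 x)) \<le> M * (norm T2 * norm x)"
          using semigroup_norm_le[OF T M, of s "T2 x"] norm_blinfun[of T2 x] M0
          by (auto intro: order_trans mult_left_mono)
        also have "\<dots> \<le> (M + M\<^sup>2) * (norm T2 * norm x)"
          by (intro mult_right_mono) auto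
        finally have "2 * norm T1 * norm (T s (T2 x)) \<le> 2 * norm T1 * ((M + M\<^sup>2) * (norm T2 * norm x))"
          by (intro mult_left_mono) auto
        with \<psi>_le[of "T s (T2 x)"] show "cmod (g s) \<le> K"
          by (simp add: g_def K_def algebra_simps)
      qed
      have "bounded_linear (\<lambda>f. \<phi> (blinfun_apply f x))"
        by (rule bounded_linear_compose[OF \<phi>(1) blinfun.bounded_linear_left])
      then show "f holomorphic_on Omega \<alpha> c1"
        unfolding f_def by (rule functional_holomorphic[OF hol]) (simp add: \<phi>(2))
      show "\<forall>z\<in>Omega \<alpha> c1. cmod (f z) \<le> 2 * M1 * norm x * (1 + \<bar>Im z\<bar>) powr \<beta>"
      proof
        fix z assume "z \<in> Omega \<alpha> c1"
        then have "norm (F z) * norm x \<le> M1 * (1 + \<bar>Im z\<bar>) powr \<beta> * norm x"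
          using FM by (intro mult_right_mono) auto
        with \<phi>(3)[of "F z x"] norm_blinfun[of "F z" x]
        show "cmod (f z) \<le> 2 * M1 * norm x * (1 + \<bar>Im z\<bar>) powr \<beta>"
          by (simp add: f_def algebra_simps)
      qed
      show "\<forall>z. 0 < Re z \<longrightarrow> cmod (exp (of_real t * z) *
          (f z - integral {0..t} (\<lambda>s. exp (- (of_real s * z)) * g s))) \<le> K / Re z"
      proof (intro allI impI)
        fix z :: complex assume z: "0 < Re z"
        have "norm (T t (resolvent z (generator T) (T2 x))) \<le> M * (M / Re z * (norm T2 * norm x))"
        proof -
          have "norm (resolvent z (generator T) (T2 x)) \<le> M / Re z * (norm T2 * norm x)"
            using norm_blinfun[of "resolvent z (generator T)" "T2 x"] norm_blinfun[of T2 x] M0 z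
              resolvent_properties(1)[OF T M z]
            by (meson divide_nonneg_pos mult_mono norm_ge_zero order_trans)
          with M0 semigroup_norm_le[OF T M, of t "resolvent z (generator T) (T2 x)"] t show ?thesis
            by (smt (verit) mult_left_mono)
        qed
        also have "\<dots> \<le> (M + M\<^sup>2) * (norm T2 * norm x) / Re z"
          using M0 z by (simp add: power2_eq_square divide_right_mono algebra_simps)
        finally have "2 * norm T1 * norm (T t (resolvent z (generator T) (T2 x)))
            \<le> 2 * norm T1 * ((M + M\<^sup>2) * (norm T2 * norm x) / Re z)"
          by (intro mult_left_mono) auto
        also have "\<dots> = K / Re z" by (simp add: K_def)
        finally show "cmod (exp (of_real t * z) *
          (f z - integral {0..t} (\<lambda>s. exp (- (of_real s * z)) * g s))) \<le> K / Re z"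
          unfolding diff[OF z] using \<psi>_le order_trans by blast
      qed
    qed
    also have "\<dots> \<le> c (norm T1) (norm T2) * ?rate * norm x"
    proof -
      have "C * (K + 2 * M1 * norm x) + C * norm x = c (norm T1) (norm T2) * norm x"
        using M0 M1 by (simp add: c_def K_def algebra_simps)
      then have "C * (K + 2 * M1 * norm x) \<le> c (norm T1) (norm T2) * norm x"
        using C by (smt (verit) mult_nonneg_nonneg norm_ge_zero)
      from mult_right_mono[OF this, of ?rate] show ?thesis
        by (simp add: mult_ac)
    qed
    finally show "norm ?v \<le> c (norm T1) (norm T2) * ?rate * norm x" .
  qed
  show ?thesis
    by (rule exI[of _ c]) (use c_pos main in blast)
qed

end
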